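(* Let $(H,\mathcal{R})$ be a quasitriangular bialgebra over a field $\Bbbk$ and let $\chi\in H\otimes H$. Then $\chi$ is an infinitesimal $\mathcal{R}$-matrix for $(H,\mathcal{R})$ if and only if all of the following hold: (i) $\chi$ is a $2$-cocycle, i.e. $\chi_{12}+(\Delta\otimes\mathrm{Id})(\chi)=\chi_{23}+(\mathrm{Id}\otimes\Delta)(\chi)$; (ii) $\chi\Delta(h)=\Delta(h)\chi$ for all $h\in H$; (iii) at least one of the two equalities $(\mathrm{Id}\otimes\Delta)(\chi)=\chi_{12}+\mathcal{R}_{12}^{-1}\chi_{13}\mathcal{R}_{12}$ and $(\Delta\otimes\mathrm{Id})(\chi)=\chi_{23}+\mathcal{R}_{23}^{-1}\chi_{13}\mathcal{R}_{23}$ holds.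
   Context: Everything is over a field $\Bbbk$, $\otimes=\otimes_{\Bbbk}$. For a bialgebra $H$ with comultiplication $\Delta$ and $T=\sum_i T^i\otimes T_i\in H\otimes H$ write $T_{12}=T\otimes 1$, $T_{23}=1\otimes T$, $T_{13}=\sum_i T^i\otimes 1\otimes T_i$; $\Delta^{\mathrm{op}}=\tau\Delta$ with $\tau$ the flip. A quasitriangular bialgebra $(H,\mathcal{R})$ is a bialgebra $H$ with an invertible $\mathcal{R}\in H\otimes H$ such that $\Delta^{\mathrm{op}}(h)=\mathcal{R}\Delta(h)\mathcal{R}^{-1}$ for all $h\in H$, $(\mathrm{Id}\otimes\Delta)(\mathcal{R})=\mathcal{R}_{13}\mathcal{R}_{12}$ and $(\Delta\otimes\mathrm{Id})(\mathcal{R})=\mathcal{R}_{13}\mathcal{R}_{23}$. An infinitesimal $\mathcal{R}$-matrix for $(H,\mathcal{R})$ is an element $\chi\in H\otimes H$ such that $\chi\Delta(h)=\Delta(h)\chi$ for all $h\in H$, $(\mathrm{Id}\otimes\Delta)(\chi)=\chi_{12}+\mathcal{R}_{12}^{-1}\chi_{13}\mathcal{R}_{12}$, and $(\Delta\otimes\mathrm{Id})(\chi)=\chi_{23}+\mathcal{R}_{23}^{-1}\chi_{13}\mathcal{R}_{23}$. *)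

theory Defs
  imports Complex_Main "HOL-Library.Poly_Mapping" "HOL-Algebra.Module"
begin

section \<open>Algebras over a field\<close>

text \<open>
  The base field is the type \<open>'k\<close>, the underlying ring of the algebra is the type \<open>'a\<close>, and
  \<open>scale\<close> is the scalar action.  The class \<open>ring_1\<close> demands \<open>0 \<noteq> 1\<close>; for a bialgebra this is no
  restriction, since the counit sends \<open>1\<close> to \<open>1\<close>.
\<close>

locale field_algebra = vector_space scale
  for scale :: "'k::field \<Rightarrow> 'a::ring_1 \<Rightarrow> 'a" +
  assumes scale_mult_left: "scale c x * y = scale c (x * y)"
    and scale_mult_right: "x * scale c y = scale c (x * y)"

definition algebra_record :: "('k::field \<Rightarrow> 'a::ring_1 \<Rightarrow> 'a) \<Rightarrow> ('k, 'a) module" where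
  "algebra_record scale =
    \<lparr>carrier = UNIV, monoid.mult = (*), one = 1, zero = 0, add = (+), smult = scale\<rparr>"


section \<open>Tensor powers\<close>

text \<open>
  The \<open>n\<close>-th tensor power of \<open>H\<close> is the vector space freely generated by the lists of length \<open>n\<close>
  with entries in \<open>H\<close>, modulo the subspace spanned by the multilinearity relations.
  A list \<open>[x\<^sub>1, \<dots>, x\<^sub>n]\<close> stands for the pure tensor of its entries, and elements of the
  tensor power are cosets of formal linear combinations of lists.  In this model
  \<open>(H \<otimes> H) \<otimes> H\<close> and \<open>H \<otimes> (H \<otimes> H)\<close> are both the third tensor power.
\<close>

type_synonym ('k, 'a) tensor = "('a list \<Rightarrow>\<^sub>0 'k) set"

definition formal_scale :: "'k::field \<Rightarrow> ('b \<Rightarrow>\<^sub>0 'k) \<Rightarrow> ('b \<Rightarrow>\<^sub>0 'k)" where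
  "formal_scale c p = Poly_Mapping.map ((*) c) p"

lemma lookup_formal_scale [simp]: "Poly_Mapping.lookup (formal_scale c p) x = c * Poly_Mapping.lookup p x"
  by (simp add: formal_scale_def Poly_Mapping.map.rep_eq when_def)

interpretation formal: vector_space formal_scale
  by unfold_locales
    (auto intro!: poly_mapping_eqI simp: lookup_add algebra_simps)

definition formal_bilinear ::
    "('b \<Rightarrow> 'c \<Rightarrow> 'd) \<Rightarrow> ('b \<Rightarrow>\<^sub>0 'k::field) \<Rightarrow> ('c \<Rightarrow>\<^sub>0 'k) \<Rightarrow> ('d \<Rightarrow>\<^sub>0 'k)" where
  "formal_bilinear g p q =
    (\<Sum>x\<in>Poly_Mapping.keys p. \<Sum>y\<in>Poly_Mapping.keys q.
      Poly_Mapping.single (g x y) (Poly_Mapping.lookup p x * Poly_Mapping.lookup q y))"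

definition multilinear_relations ::
    "('k::field \<Rightarrow> 'a::ring_1 \<Rightarrow> 'a) \<Rightarrow> nat \<Rightarrow> ('a list \<Rightarrow>\<^sub>0 'k) set" where
  "multilinear_relations scale n =
    {Poly_Mapping.single (us @ (x + y) # vs) 1
       - Poly_Mapping.single (us @ x # vs) 1 - Poly_Mapping.single (us @ y # vs) 1
     | us vs x y. length us + length vs + 1 = n}
    \<union> {Poly_Mapping.single (us @ scale c x # vs) 1
       - formal_scale c (Poly_Mapping.single (us @ x # vs) 1)
     | us vs c x. length us + length vs + 1 = n}"

definition tensor_class ::
    "('k::field \<Rightarrow> 'a::ring_1 \<Rightarrow> 'a) \<Rightarrow> nat \<Rightarrow> ('a list \<Rightarrow>\<^sub>0 'k) \<Rightarrow> ('k, 'a) tensor" where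
  "tensor_class scale n p = {q. q - p \<in> formal.span (multilinear_relations scale n)}"

definition pure_tensor :: "('k::field \<Rightarrow> 'a::ring_1 \<Rightarrow> 'a) \<Rightarrow> 'a list \<Rightarrow> ('k, 'a) tensor" where
  "pure_tensor scale xs = tensor_class scale (length xs) (Poly_Mapping.single xs 1)"

definition tensor_power ::
    "('k::field \<Rightarrow> 'a::ring_1 \<Rightarrow> 'a) \<Rightarrow> nat \<Rightarrow> ('k, ('k, 'a) tensor) module" where
  "tensor_power scale n =
    \<lparr>carrier = tensor_class scale n ` {p. \<forall>xs\<in>Poly_Mapping.keys p. length xs = n},
     monoid.mult = (\<lambda>S T. \<Union>p\<in>S. \<Union>q\<in>T. tensor_class scale n (formal_bilinear (map2 (*)) p q)),
     one = pure_tensor scale (replicate n 1),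
     zero = tensor_class scale n 0,
     add = (\<lambda>S T. \<Union>p\<in>S. \<Union>q\<in>T. tensor_class scale n (p + q)),
     smult = (\<lambda>c S. \<Union>p\<in>S. tensor_class scale n (formal_scale c p))\<rparr>"

text \<open>
  The canonical map from the product of the \<open>m\<close>-th and the \<open>n\<close>-th tensor power to the
  \<open>(m + n)\<close>-th one: on pure tensors it appends the lists of factors.
\<close>

definition tensor_append ::
    "('k::field \<Rightarrow> 'a::ring_1 \<Rightarrow> 'a) \<Rightarrow> nat \<Rightarrow> nat \<Rightarrow>
      ('k, 'a) tensor \<Rightarrow> ('k, 'a) tensor \<Rightarrow> ('k, 'a) tensor" where
  "tensor_append scale m n S T =
    (\<Union>p\<in>S. \<Union>q\<in>T. tensor_class scale (m + n) (formal_bilinear (@) p q))"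

text \<open>
  The linear map into \<open>M\<close> induced by a multilinear map \<open>f\<close> (given on lists of factors): its value
  at \<open>T\<close> is the common value of \<open>\<Sum>\<^sub>i c\<^sub>i f(xs\<^sub>i)\<close> over all the formal combinations \<open>\<Sum>\<^sub>i c\<^sub>i xs\<^sub>i\<close>
  that represent \<open>T\<close>.
\<close>

definition tensor_lift ::
    "('k::field, 'm) module \<Rightarrow> ('a list \<Rightarrow> 'm) \<Rightarrow> ('k, 'a) tensor \<Rightarrow> 'm" where
  "tensor_lift M f T =
    (THE y. \<forall>p\<in>T.
      y = (\<Oplus>\<^bsub>M\<^esub>xs\<in>Poly_Mapping.keys p. Poly_Mapping.lookup p xs \<odot>\<^bsub>M\<^esub> f xs))"


section \<open>Leg notation and the maps induced by the comultiplication\<close>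

definition leg12 :: "('k::field \<Rightarrow> 'a::ring_1 \<Rightarrow> 'a) \<Rightarrow> ('k, 'a) tensor \<Rightarrow> ('k, 'a) tensor" where
  "leg12 scale T = tensor_append scale 2 1 T (pure_tensor scale [1])"

definition leg23 :: "('k::field \<Rightarrow> 'a::ring_1 \<Rightarrow> 'a) \<Rightarrow> ('k, 'a) tensor \<Rightarrow> ('k, 'a) tensor" where
  "leg23 scale T = tensor_append scale 1 2 (pure_tensor scale [1]) T"

definition leg13 :: "('k::field \<Rightarrow> 'a::ring_1 \<Rightarrow> 'a) \<Rightarrow> ('k, 'a) tensor \<Rightarrow> ('k, 'a) tensor" where
  "leg13 scale = tensor_lift (tensor_power scale 3) (\<lambda>xs. pure_tensor scale [xs ! 0, 1, xs ! 1])"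

definition tensor_flip :: "('k::field \<Rightarrow> 'a::ring_1 \<Rightarrow> 'a) \<Rightarrow> ('k, 'a) tensor \<Rightarrow> ('k, 'a) tensor" where
  "tensor_flip scale = tensor_lift (tensor_power scale 2) (\<lambda>xs. pure_tensor scale [xs ! 1, xs ! 0])"

definition id_comult ::
    "('k::field \<Rightarrow> 'a::ring_1 \<Rightarrow> 'a) \<Rightarrow> ('a \<Rightarrow> ('k, 'a) tensor) \<Rightarrow>
      ('k, 'a) tensor \<Rightarrow> ('k, 'a) tensor" where
  "id_comult scale \<Delta> =
    tensor_lift (tensor_power scale 3)
      (\<lambda>xs. tensor_append scale 1 2 (pure_tensor scale [xs ! 0]) (\<Delta> (xs ! 1)))"

definition comult_id ::
    "('k::field \<Rightarrow> 'a::ring_1 \<Rightarrow> 'a) \<Rightarrow> ('a \<Rightarrow> ('k, 'a) tensor) \<Rightarrow>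
      ('k, 'a) tensor \<Rightarrow> ('k, 'a) tensor" where
  "comult_id scale \<Delta> =
    tensor_lift (tensor_power scale 3)
      (\<lambda>xs. tensor_append scale 2 1 (\<Delta> (xs ! 0)) (pure_tensor scale [xs ! 1]))"


section \<open>Quasitriangular bialgebras\<close>

locale bialgebra = field_algebra scale
  for scale :: "'k::field \<Rightarrow> 'a::ring_1 \<Rightarrow> 'a"
    and \<Delta> :: "'a \<Rightarrow> ('k, 'a) tensor"
    and \<epsilon> :: "'a \<Rightarrow> 'k" +
  assumes comult_hom: "\<Delta> \<in> ring_hom (algebra_record scale) (tensor_power scale 2)"
    and comult_scale: "\<Delta> (scale c h) = c \<odot>\<^bsub>tensor_power scale 2\<^esub> \<Delta> h"
    and counit_linear: "Vector_Spaces.linear scale (*) \<epsilon>"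
    and counit_one: "\<epsilon> 1 = 1"
    and counit_mult: "\<epsilon> (g * h) = \<epsilon> g * \<epsilon> h"
    and coassoc: "comult_id scale \<Delta> (\<Delta> h) = id_comult scale \<Delta> (\<Delta> h)"
    and counit_left:
      "tensor_lift (algebra_record scale) (\<lambda>xs. scale (\<epsilon> (xs ! 0)) (xs ! 1)) (\<Delta> h) = h"
    and counit_right:
      "tensor_lift (algebra_record scale) (\<lambda>xs. scale (\<epsilon> (xs ! 1)) (xs ! 0)) (\<Delta> h) = h"

locale quasitriangular_bialgebra = bialgebra scale \<Delta> \<epsilon>
  for scale :: "'k::field \<Rightarrow> 'a::ring_1 \<Rightarrow> 'a"
    and \<Delta> :: "'a \<Rightarrow> ('k, 'a) tensor"
    and \<epsilon> :: "'a \<Rightarrow> 'k"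
    and R :: "('k, 'a) tensor" +
  assumes R_invertible: "R \<in> Units (tensor_power scale 2)"
    and R_comult_op:
      "tensor_flip scale (\<Delta> h) =
        R \<otimes>\<^bsub>tensor_power scale 2\<^esub> \<Delta> h \<otimes>\<^bsub>tensor_power scale 2\<^esub> inv\<^bsub>tensor_power scale 2\<^esub> R"
    and R_id_comult:
      "id_comult scale \<Delta> R = leg13 scale R \<otimes>\<^bsub>tensor_power scale 3\<^esub> leg12 scale R"
    and R_comult_id:
      "comult_id scale \<Delta> R = leg13 scale R \<otimes>\<^bsub>tensor_power scale 3\<^esub> leg23 scale R"


section \<open>Infinitesimal R-matrices\<close>

definition commutes_with_comult ::
    "('k::field \<Rightarrow> 'a::ring_1 \<Rightarrow> 'a) \<Rightarrow> ('a \<Rightarrow> ('k, 'a) tensor) \<Rightarrow> ('k, 'a) tensor \<Rightarrow> bool" where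
  "commutes_with_comult scale \<Delta> \<chi> \<longleftrightarrow>
    (\<forall>h. \<chi> \<otimes>\<^bsub>tensor_power scale 2\<^esub> \<Delta> h = \<Delta> h \<otimes>\<^bsub>tensor_power scale 2\<^esub> \<chi>)"

definition id_comult_condition ::
    "('k::field \<Rightarrow> 'a::ring_1 \<Rightarrow> 'a) \<Rightarrow> ('a \<Rightarrow> ('k, 'a) tensor) \<Rightarrow>
      ('k, 'a) tensor \<Rightarrow> ('k, 'a) tensor \<Rightarrow> bool" where
  "id_comult_condition scale \<Delta> R \<chi> \<longleftrightarrow>
    id_comult scale \<Delta> \<chi> =
      leg12 scale \<chi> \<oplus>\<^bsub>tensor_power scale 3\<^esub>
      (inv\<^bsub>tensor_power scale 3\<^esub> (leg12 scale R) \<otimes>\<^bsub>tensor_power scale 3\<^esub> leg13 scale \<chi>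
        \<otimes>\<^bsub>tensor_power scale 3\<^esub> leg12 scale R)"

definition comult_id_condition ::
    "('k::field \<Rightarrow> 'a::ring_1 \<Rightarrow> 'a) \<Rightarrow> ('a \<Rightarrow> ('k, 'a) tensor) \<Rightarrow>
      ('k, 'a) tensor \<Rightarrow> ('k, 'a) tensor \<Rightarrow> bool" where
  "comult_id_condition scale \<Delta> R \<chi> \<longleftrightarrow>
    comult_id scale \<Delta> \<chi> =
      leg23 scale \<chi> \<oplus>\<^bsub>tensor_power scale 3\<^esub>
      (inv\<^bsub>tensor_power scale 3\<^esub> (leg23 scale R) \<otimes>\<^bsub>tensor_power scale 3\<^esub> leg13 scale \<chi>
        \<otimes>\<^bsub>tensor_power scale 3\<^esub> leg23 scale R)"

definition infinitesimal_R_matrix ::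
    "('k::field \<Rightarrow> 'a::ring_1 \<Rightarrow> 'a) \<Rightarrow> ('a \<Rightarrow> ('k, 'a) tensor) \<Rightarrow>
      ('k, 'a) tensor \<Rightarrow> ('k, 'a) tensor \<Rightarrow> bool" where
  "infinitesimal_R_matrix scale \<Delta> R \<chi> \<longleftrightarrow>
    \<chi> \<in> carrier (tensor_power scale 2) \<and>
    commutes_with_comult scale \<Delta> \<chi> \<and>
    id_comult_condition scale \<Delta> R \<chi> \<and>
    comult_id_condition scale \<Delta> R \<chi>"

definition two_cocycle ::
    "('k::field \<Rightarrow> 'a::ring_1 \<Rightarrow> 'a) \<Rightarrow> ('a \<Rightarrow> ('k, 'a) tensor) \<Rightarrow> ('k, 'a) tensor \<Rightarrow> bool" where
  "two_cocycle scale \<Delta> \<chi> \<longleftrightarrow>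
    leg12 scale \<chi> \<oplus>\<^bsub>tensor_power scale 3\<^esub> comult_id scale \<Delta> \<chi> =
    leg23 scale \<chi> \<oplus>\<^bsub>tensor_power scale 3\<^esub> id_comult scale \<Delta> \<chi>"

end

theory Submission
  imports Defs
begin

text \<open>
  Write \<open>A = R\<^sub>1\<^sub>2\<inverse> \<chi>\<^sub>1\<^sub>3 R\<^sub>1\<^sub>2\<close> and \<open>B = R\<^sub>2\<^sub>3\<inverse> \<chi>\<^sub>1\<^sub>3 R\<^sub>2\<^sub>3\<close>.  If \<open>A = B\<close>, then the 2-cocycle condition turns either of the
  two coproduct formulas for \<open>\<chi>\<close> into the other, and both together imply it.  So it suffices that
  \<open>A = B\<close> follows from the commutation of \<open>\<chi>\<close> with \<open>\<Delta>\<close> and one of the formulas, say the one for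
  \<open>(Id \<otimes> \<Delta>)(\<chi>)\<close>.  Swapping the last two legs conjugates \<open>(Id \<otimes> \<Delta>)(\<chi>) = \<chi>\<^sub>1\<^sub>2 + A\<close> by \<open>R\<^sub>2\<^sub>3\<close>, and
  turns it into \<open>\<chi>\<^sub>1\<^sub>3 + R\<^sub>1\<^sub>3\<inverse> \<chi>\<^sub>1\<^sub>2 R\<^sub>1\<^sub>3\<close>; undoing the conjugation gives
  \<open>\<chi>\<^sub>1\<^sub>2 + A = B + (R\<^sub>1\<^sub>3 R\<^sub>2\<^sub>3)\<inverse> \<chi>\<^sub>1\<^sub>2 (R\<^sub>1\<^sub>3 R\<^sub>2\<^sub>3)\<close>.  Since \<open>\<chi>\<^sub>1\<^sub>2\<close> commutes with
  \<open>(\<Delta> \<otimes> Id)(R) = R\<^sub>1\<^sub>3 R\<^sub>2\<^sub>3\<close>, the last summand is \<open>\<chi>\<^sub>1\<^sub>2\<close>.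
\<close>

section \<open>Formal linear combinations\<close>

text \<open>Keys can cancel in \<open>p + p'\<close>, so sums over the keys of \<open>p\<close>,
  \<open>p'\<close> and \<open>p + p'\<close> do not match term by term. Enlarging the index sets
  adds only zero terms and lets all of them run over one common set.\<close>

lemma formal_bilinear_superset:
  assumes "finite A" "Poly_Mapping.keys p \<subseteq> A" "finite B" "Poly_Mapping.keys q \<subseteq> B"
  shows "formal_bilinear g p q =
    (\<Sum>x\<in>A. \<Sum>y\<in>B.
      Poly_Mapping.single (g x y) (Poly_Mapping.lookup p x * Poly_Mapping.lookup q y))"
proof -
  have "(\<Sum>y\<in>Poly_Mapping.keys q.
      Poly_Mapping.single (g x y) (Poly_Mapping.lookup p x * Poly_Mapping.lookup q y)) =
    (\<Sum>y\<in>B. Poly_Mapping.single (g x y) (Poly_Mapping.lookup p x * Poly_Mapping.lookup q y))" for x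
    using assms by (intro sum.mono_neutral_left) (auto simp: in_keys_iff)
  then show ?thesis
    unfolding formal_bilinear_def
    using assms by (simp, intro sum.mono_neutral_left) (auto simp: in_keys_iff)
qed

lemma formal_bilinear_add_left:
  "formal_bilinear g (p + p') q = formal_bilinear g p q + formal_bilinear g p' q"
proof -
  let ?A = "Poly_Mapping.keys p \<union> Poly_Mapping.keys p'"
  have "Poly_Mapping.keys (p + p') \<subseteq> ?A" by (rule Poly_Mapping.keys_add)
  then show ?thesis
    by (simp add: formal_bilinear_superset[of ?A _ "Poly_Mapping.keys q"] lookup_add
        single_add distrib_right sum.distrib)
qed

lemma formal_bilinear_add_right:
  "formal_bilinear g p (q + q') = formal_bilinear g p q + formal_bilinear g p q'"
proof -
  let ?B = "Poly_Mapping.keys q \<union> Poly_Mapping.keys q'"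
  have "Poly_Mapping.keys (q + q') \<subseteq> ?B" by (rule Poly_Mapping.keys_add)
  then show ?thesis
    by (simp add: formal_bilinear_superset[of "Poly_Mapping.keys p" _ ?B] lookup_add
        single_add distrib_left sum.distrib)
qed

lemma formal_scale_single [simp]:
  "formal_scale c (Poly_Mapping.single x d) = Poly_Mapping.single x (c * d)"
  by (rule poly_mapping_eqI) (simp add: lookup_single when_def)

lemma keys_formal_scale: "Poly_Mapping.keys (formal_scale c p) \<subseteq> Poly_Mapping.keys p"
  by (auto simp: in_keys_iff)

lemma formal_bilinear_scale_left:
  "formal_bilinear g (formal_scale c p) q = formal_scale c (formal_bilinear g p q)"
  using keys_formal_scale[of c p]
  by (simp add: formal_bilinear_superset[of "Poly_Mapping.keys p" _ "Poly_Mapping.keys q"]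
      formal.scale_sum_right mult.assoc)

lemma formal_bilinear_scale_right:
  "formal_bilinear g p (formal_scale c q) = formal_scale c (formal_bilinear g p q)"
  using keys_formal_scale[of c q]
  by (simp add: formal_bilinear_superset[of "Poly_Mapping.keys p" _ "Poly_Mapping.keys q"]
      formal.scale_sum_right mult_ac)

lemma formal_bilinear_diff_left:
  "formal_bilinear g (p - p') q = formal_bilinear g p q - formal_bilinear g p' q"
  using formal_bilinear_add_left[of g "p - p'" p' q] by simp

lemma formal_bilinear_diff_right:
  "formal_bilinear g p (q - q') = formal_bilinear g p q - formal_bilinear g p q'"
  using formal_bilinear_add_right[of g p "q - q'" q'] by simp

lemma formal_bilinear_zero [simp]:
  "formal_bilinear g 0 q = 0" "formal_bilinear g p 0 = 0"
  by (simp_all add: formal_bilinear_def)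

lemma formal_bilinear_single [simp]:
  "formal_bilinear g (Poly_Mapping.single x c) (Poly_Mapping.single y d) =
    Poly_Mapping.single (g x y) (c * d)"
  by (simp add: formal_bilinear_superset[of "{x}" _ "{y}"])

lemma formal_eq_sum:
  "p = (\<Sum>x\<in>Poly_Mapping.keys p. formal_scale (Poly_Mapping.lookup p x) (Poly_Mapping.single x 1))"
  by (rule poly_mapping_eqI) (auto simp: lookup_sum lookup_single when_def in_keys_iff)

lemma formal_bilinear_sum_left:
  "formal_bilinear g p q = (\<Sum>x\<in>Poly_Mapping.keys p.
    formal_scale (Poly_Mapping.lookup p x) (formal_bilinear g (Poly_Mapping.single x 1) q))"
  by (simp add: formal_bilinear_superset[of "{_}" "Poly_Mapping.single _ 1" "Poly_Mapping.keys q"]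
      formal.scale_sum_right formal_bilinear_def)

text \<open>In the definition the sum over the keys of \<open>p\<close> is the outer one, so the two
  sums have to be exchanged before the coefficients of \<open>q\<close> come out.\<close>

lemma formal_bilinear_sum_right:
  "formal_bilinear g p q = (\<Sum>y\<in>Poly_Mapping.keys q.
    formal_scale (Poly_Mapping.lookup q y) (formal_bilinear g p (Poly_Mapping.single y 1)))"
  by (subst sum.swap[of _ _ "Poly_Mapping.keys p", symmetric, THEN trans[rotated]])
    (simp_all add: formal_bilinear_superset[of "Poly_Mapping.keys p" _ "{_}" "Poly_Mapping.single _ 1"]
      formal.scale_sum_right formal_bilinear_def mult.commute sum.swap[of _ _ "Poly_Mapping.keys p"])

text \<open>A multilinearity relation varies a single slot. A list that is multiplied with it
  entrywise has to be cut at that same slot.\<close>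

lemma split_list_at:
  assumes "length ys = length us + length vs + 1"
  obtains ws w zs where "ys = ws @ w # zs" "length ws = length us" "length zs = length vs"
  using assms id_take_nth_drop[of "length us" ys]
  by (intro that[of "take (length us) ys" "ys ! length us" "drop (Suc (length us)) ys"]) auto

text \<open>The classes of these combinations are the elements of the tensor power. Homogeneity
  matters because \<open>map2\<close> truncates to the shorter list, so entrywise products are
  controlled only between lists of equal length.\<close>

definition formal_power :: "nat \<Rightarrow> ('a list \<Rightarrow>\<^sub>0 'k::field) set" where
  "formal_power n = {p. \<forall>xs\<in>Poly_Mapping.keys p. length xs = n}"

lemma single_formal_power [simp]:
  "length xs = n \<Longrightarrow> Poly_Mapping.single xs c \<in> formal_power n"
  by (simp add: formal_power_def)

lemma subspace_formal_power: "formal.subspace (formal_power n)"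
proof -
  \<comment> \<open>Expressed through coefficients, membership is a family of homogeneous linear
    equations.\<close>
  have "formal_power n = {p. \<forall>xs. length xs \<noteq> n \<longrightarrow> Poly_Mapping.lookup p xs = 0}"
    by (auto simp: formal_power_def in_keys_iff)
  then show ?thesis
    by (auto intro!: formal.subspaceI simp: lookup_add)
qed

lemmas formal_power_intros [simp, intro] =
  formal.subspace_0[OF subspace_formal_power]
  formal.subspace_add[OF subspace_formal_power]
  formal.subspace_diff[OF subspace_formal_power]
  formal.subspace_scale[OF subspace_formal_power]

lemma formal_bilinear_formal_power:
  assumes "p \<in> formal_power m" "q \<in> formal_power n"
    and "\<And>xs ys. length xs = m \<Longrightarrow> length ys = n \<Longrightarrow> length (g xs ys) = k"
  shows "formal_bilinear g p q \<in> formal_power k"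
  unfolding formal_bilinear_def using assms
  by (intro formal.subspace_sum[OF subspace_formal_power]) (simp add: formal_power_def)

section \<open>Tensor powers\<close>

context field_algebra
begin

section \<open>The space of multilinearity relations and its cosets\<close>

abbreviation relation_span :: "nat \<Rightarrow> ('a list \<Rightarrow>\<^sub>0 'k) set" where
  "relation_span n \<equiv> formal.span (multilinear_relations scale n)"

lemma relation_span_subset: "relation_span n \<subseteq> formal_power n"
  by (rule formal.span_minimal[OF _ subspace_formal_power])
    (auto simp: multilinear_relations_def simp del: formal_scale_single)

lemma add_relation:
  "length us + length vs + 1 = n \<Longrightarrow>
    Poly_Mapping.single (us @ (x + y) # vs) 1
      - Poly_Mapping.single (us @ x # vs) 1 - Poly_Mapping.single (us @ y # vs) 1 \<in> relation_span n"
  by (rule formal.span_base) (auto simp: multilinear_relations_def)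

lemma scale_relation:
  "length us + length vs + 1 = n \<Longrightarrow>
    Poly_Mapping.single (us @ scale c x # vs) 1
      - formal_scale c (Poly_Mapping.single (us @ x # vs) 1) \<in> relation_span n"
  unfolding multilinear_relations_def by (rule formal.span_base, rule UnI2, blast)

lemma mem_tensor_class: "q \<in> tensor_class scale n p \<longleftrightarrow> q - p \<in> relation_span n"
  by (simp add: tensor_class_def)

lemma tensor_class_self [simp]: "p \<in> tensor_class scale n p"
  by (simp add: mem_tensor_class formal.span_zero)

lemma tensor_class_eq_iff:
  "tensor_class scale n p = tensor_class scale n q \<longleftrightarrow> p - q \<in> relation_span n"
proof
  assume "tensor_class scale n p = tensor_class scale n q"
  then show "p - q \<in> relation_span n"
    using tensor_class_self[of p n] by (simp add: mem_tensor_class)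
next
  assume *: "p - q \<in> relation_span n"
  have "r - p \<in> relation_span n \<longleftrightarrow> r - q \<in> relation_span n" for r
    using formal.span_add[OF _ *, of "r - p"] formal.span_diff[OF _ *, of "r - q"] by auto
  then show "tensor_class scale n p = tensor_class scale n q"
    by (auto simp: mem_tensor_class)
qed

text \<open>A class is a coset of the relation space, and the relations involve lists of length
  \<open>n\<close> only. So passing to another representative preserves homogeneity.\<close>

lemma tensor_class_formal_power:
  "p' \<in> tensor_class scale n p \<Longrightarrow> p \<in> formal_power n \<Longrightarrow> p' \<in> formal_power n"
  using relation_span_subset[of n] formal_power_intros(2)[of "p' - p" n p]
  by (auto simp: mem_tensor_class)

lemma carrier_tensor_power: "carrier (tensor_power scale n) = tensor_class scale n ` formal_power n"
  by (simp add: tensor_power_def formal_power_def)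

lemma zero_tensor_power: "\<zero>\<^bsub>tensor_power scale n\<^esub> = tensor_class scale n 0"
  by (simp add: tensor_power_def)

lemma one_tensor_power: "\<one>\<^bsub>tensor_power scale n\<^esub> = pure_tensor scale (replicate n 1)"
  by (simp add: tensor_power_def)

text \<open>\<open>tensor_power\<close> takes a union over all representatives. Changing them alters
  the sum by an element of the relation space, so all the classes in the union are equal and it
  collapses to one.\<close>

lemma add_tensor_class:
  "tensor_class scale n p \<oplus>\<^bsub>tensor_power scale n\<^esub> tensor_class scale n q =
    tensor_class scale n (p + q)"
proof -
  have "tensor_class scale n (p' + q') = tensor_class scale n (p + q)"
    if "p' \<in> tensor_class scale n p" "q' \<in> tensor_class scale n q" for p' q'
    using that formal.span_add[of "p' - p" _ "q' - q"]
    by (simp add: mem_tensor_class tensor_class_eq_iff add_diff_add)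
  then have "(\<Union>p'\<in>tensor_class scale n p. \<Union>q'\<in>tensor_class scale n q. tensor_class scale n (p' + q'))
      = tensor_class scale n (p + q)"
    using tensor_class_self by blast
  then show ?thesis
    by (simp add: tensor_power_def)
qed

lemma smult_tensor_class:
  "c \<odot>\<^bsub>tensor_power scale n\<^esub> tensor_class scale n p = tensor_class scale n (formal_scale c p)"
proof -
  have "tensor_class scale n (formal_scale c p') = tensor_class scale n (formal_scale c p)"
    if "p' \<in> tensor_class scale n p" for p'
    using that formal.span_scale[of "p' - p" _ c]
    by (simp add: mem_tensor_class tensor_class_eq_iff formal.scale_right_diff_distrib)
  then have "(\<Union>p'\<in>tensor_class scale n p. tensor_class scale n (formal_scale c p'))
      = tensor_class scale n (formal_scale c p)"
    using tensor_class_self by blast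
  then show ?thesis
    by (simp add: tensor_power_def)
qed

text \<open>The condition under which the bilinear extension of \<open>g\<close> induces a map on
  tensor powers. It is asked only for generating relations against single lists, where it can be
  verified directly, and it covers both the entrywise product and concatenation.\<close>

definition multilinear_pairing ::
    "nat \<Rightarrow> nat \<Rightarrow> nat \<Rightarrow> ('a list \<Rightarrow> 'a list \<Rightarrow> 'a list) \<Rightarrow> bool" where
  "multilinear_pairing m n k g \<longleftrightarrow>
    (\<forall>xs ys. length xs = m \<longrightarrow> length ys = n \<longrightarrow> length (g xs ys) = k) \<and>
    (\<forall>r\<in>multilinear_relations scale m. \<forall>ys. length ys = n \<longrightarrow>
      formal_bilinear g r (Poly_Mapping.single ys 1) \<in> relation_span k) \<and>
    (\<forall>r\<in>multilinear_relations scale n. \<forall>xs. length xs = m \<longrightarrow>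
      formal_bilinear g (Poly_Mapping.single xs 1) r \<in> relation_span k)"

text \<open>The elements \<open>r\<close> with this property form a subspace, which reduces the
  claim to generating relations; then \<open>q\<close> is expanded into single lists.\<close>

lemma multilinear_pairing_span_left:
  assumes g: "multilinear_pairing m n k g" and r: "r \<in> relation_span m" and q: "q \<in> formal_power n"
  shows "formal_bilinear g r q \<in> relation_span k"
  using r
proof (induction r rule: formal.span_induct)
  case base
  show ?case
    by (rule formal.subspaceI)
      (simp_all add: formal.span_zero formal.span_add formal.span_scale
        formal_bilinear_add_left formal_bilinear_scale_left)
next
  case (step r)
  then show ?case
    using g q unfolding formal_bilinear_sum_right[of g r q]
    by (intro formal.span_sum formal.span_scale) (simp add: multilinear_pairing_def formal_power_def)
qed

lemma multilinear_pairing_span_right: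
  assumes g: "multilinear_pairing m n k g" and p: "p \<in> formal_power m" and r: "r \<in> relation_span n"
  shows "formal_bilinear g p r \<in> relation_span k"
  using r
proof (induction r rule: formal.span_induct)
  case base
  show ?case
    by (rule formal.subspaceI)
      (simp_all add: formal.span_zero formal.span_add formal.span_scale
        formal_bilinear_add_right formal_bilinear_scale_right)
next
  case (step r)
  then show ?case
    using g p unfolding formal_bilinear_sum_left[of g p r]
    by (intro formal.span_sum formal.span_scale) (simp add: multilinear_pairing_def formal_power_def)
qed

lemma UN_formal_bilinear:
  assumes g: "multilinear_pairing m n k g" and p: "p \<in> formal_power m" and q: "q \<in> formal_power n"
  shows "(\<Union>p'\<in>tensor_class scale m p. \<Union>q'\<in>tensor_class scale n q.
      tensor_class scale k (formal_bilinear g p' q')) = tensor_class scale k (formal_bilinear g p q)"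
proof -
  have "tensor_class scale k (formal_bilinear g p' q') = tensor_class scale k (formal_bilinear g p q)"
    if p': "p' \<in> tensor_class scale m p" and q': "q' \<in> tensor_class scale n q" for p' q'
  proof -
    \<comment> \<open>This sum is the difference of the two values, with one argument changed at a
      time. Its first term uses that \<open>q'\<close> is homogeneous, being in the class of
      \<open>q\<close>.\<close>
    have "formal_bilinear g (p' - p) q' + formal_bilinear g p (q' - q) \<in> relation_span k"
      using p' q' tensor_class_formal_power[OF q' q]
      by (intro formal.span_add multilinear_pairing_span_left[OF g]
          multilinear_pairing_span_right[OF g p]) (simp_all add: mem_tensor_class)
    then show ?thesis
      by (simp add: tensor_class_eq_iff formal_bilinear_diff_left formal_bilinear_diff_right)
  qed
  then show ?thesis
    using tensor_class_self by blast
qed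

text \<open>By distributivity, or by \<open>scale_mult_left\<close> and
  \<open>scale_mult_right\<close>, multiplying a relation entrywise with a list gives a relation of
  the same kind in the same slot.\<close>

lemma multilinear_pairing_map2_mult: "multilinear_pairing n n n (map2 (*))"
  unfolding multilinear_pairing_def
proof (intro conjI ballI allI impI)
  fix r :: "'a list \<Rightarrow>\<^sub>0 'k" and ys :: "'a list"
  assume r: "r \<in> multilinear_relations scale n" and ys: "length ys = n"
  show "formal_bilinear (map2 (*)) r (Poly_Mapping.single ys 1) \<in> relation_span n"
    using r[unfolded multilinear_relations_def]
  proof (elim UnE CollectE exE conjE)
    fix us vs x y
    assume r: "r = Poly_Mapping.single (us @ (x + y) # vs) 1
       - Poly_Mapping.single (us @ x # vs) 1 - Poly_Mapping.single (us @ y # vs) 1"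
      and l: "length us + length vs + 1 = n"
    obtain ws w zs where "ys = ws @ w # zs" "length ws = length us" "length zs = length vs"
      using split_list_at[of ys us vs] l ys by auto
    with l show ?thesis
      using add_relation[of "map2 (*) us ws" "map2 (*) vs zs" n "x * w" "y * w"]
      by (simp add: r formal_bilinear_diff_left distrib_right)
  next
    fix us vs c x
    assume r: "r = Poly_Mapping.single (us @ scale c x # vs) 1
       - formal_scale c (Poly_Mapping.single (us @ x # vs) 1)"
      and l: "length us + length vs + 1 = n"
    obtain ws w zs where "ys = ws @ w # zs" "length ws = length us" "length zs = length vs"
      using split_list_at[of ys us vs] l ys by auto
    with l show ?thesis
      using scale_relation[of "map2 (*) us ws" "map2 (*) vs zs" n c "x * w"]
      by (simp add: r formal_bilinear_diff_left scale_mult_left)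
  qed
next
  fix r :: "'a list \<Rightarrow>\<^sub>0 'k" and ys :: "'a list"
  assume r: "r \<in> multilinear_relations scale n" and ys: "length ys = n"
  show "formal_bilinear (map2 (*)) (Poly_Mapping.single ys 1) r \<in> relation_span n"
    using r[unfolded multilinear_relations_def]
  proof (elim UnE CollectE exE conjE)
    fix us vs x y
    assume r: "r = Poly_Mapping.single (us @ (x + y) # vs) 1
       - Poly_Mapping.single (us @ x # vs) 1 - Poly_Mapping.single (us @ y # vs) 1"
      and l: "length us + length vs + 1 = n"
    obtain ws w zs where "ys = ws @ w # zs" "length ws = length us" "length zs = length vs"
      using split_list_at[of ys us vs] l ys by auto
    with l show ?thesis
      using add_relation[of "map2 (*) ws us" "map2 (*) zs vs" n "w * x" "w * y"]
      by (simp add: r formal_bilinear_diff_right distrib_left)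
  next
    fix us vs c x
    assume r: "r = Poly_Mapping.single (us @ scale c x # vs) 1
       - formal_scale c (Poly_Mapping.single (us @ x # vs) 1)"
      and l: "length us + length vs + 1 = n"
    obtain ws w zs where "ys = ws @ w # zs" "length ws = length us" "length zs = length vs"
      using split_list_at[of ys us vs] l ys by auto
    with l show ?thesis
      using scale_relation[of "map2 (*) ws us" "map2 (*) zs vs" n c "w * x"]
      by (simp add: r formal_bilinear_diff_right scale_mult_right)
  qed
qed simp

text \<open>Concatenation only lengthens the context \<open>us\<close> or \<open>vs\<close> around
  the varied slot, so relations go to relations.\<close>

lemma multilinear_pairing_append: "multilinear_pairing m n (m + n) (@)"
  unfolding multilinear_pairing_def
proof (intro conjI ballI allI impI)
  fix r :: "'a list \<Rightarrow>\<^sub>0 'k" and ys :: "'a list"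
  assume r: "r \<in> multilinear_relations scale m" and ys: "length ys = n"
  show "formal_bilinear (@) r (Poly_Mapping.single ys 1) \<in> relation_span (m + n)"
    using r[unfolded multilinear_relations_def]
  proof (elim UnE CollectE exE conjE)
    fix us vs x y
    assume "r = Poly_Mapping.single (us @ (x + y) # vs) 1
       - Poly_Mapping.single (us @ x # vs) 1 - Poly_Mapping.single (us @ y # vs) 1"
      and "length us + length vs + 1 = m"
    then show ?thesis
      using add_relation[of us "vs @ ys" "m + n" x y] ys by (simp add: formal_bilinear_diff_left)
  next
    fix us vs c x
    assume "r = Poly_Mapping.single (us @ scale c x # vs) 1
       - formal_scale c (Poly_Mapping.single (us @ x # vs) 1)"
      and "length us + length vs + 1 = m"
    then show ?thesis
      using scale_relation[of us "vs @ ys" "m + n" c x] ys by (simp add: formal_bilinear_diff_left)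
  qed
next
  fix r :: "'a list \<Rightarrow>\<^sub>0 'k" and xs :: "'a list"
  assume r: "r \<in> multilinear_relations scale n" and xs: "length xs = m"
  show "formal_bilinear (@) (Poly_Mapping.single xs 1) r \<in> relation_span (m + n)"
    using r[unfolded multilinear_relations_def]
  proof (elim UnE CollectE exE conjE)
    fix us vs x y
    assume "r = Poly_Mapping.single (us @ (x + y) # vs) 1
       - Poly_Mapping.single (us @ x # vs) 1 - Poly_Mapping.single (us @ y # vs) 1"
      and "length us + length vs + 1 = n"
    then show ?thesis
      using add_relation[of "xs @ us" vs "m + n" x y] xs by (simp add: formal_bilinear_diff_right)
  next
    fix us vs c x
    assume "r = Poly_Mapping.single (us @ scale c x # vs) 1
       - formal_scale c (Poly_Mapping.single (us @ x # vs) 1)"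
      and "length us + length vs + 1 = n"
    then show ?thesis
      using scale_relation[of "xs @ us" vs "m + n" c x] xs by (simp add: formal_bilinear_diff_right)
  qed
qed simp

section \<open>The operations on classes and pure tensors, and their linearity\<close>

lemma mult_tensor_class:
  "p \<in> formal_power n \<Longrightarrow> q \<in> formal_power n \<Longrightarrow>
    tensor_class scale n p \<otimes>\<^bsub>tensor_power scale n\<^esub> tensor_class scale n q =
    tensor_class scale n (formal_bilinear (map2 (*)) p q)"
  using UN_formal_bilinear[OF multilinear_pairing_map2_mult] by (simp add: tensor_power_def)

lemma append_tensor_class:
  "p \<in> formal_power m \<Longrightarrow> q \<in> formal_power n \<Longrightarrow>
    tensor_append scale m n (tensor_class scale m p) (tensor_class scale n q) =
    tensor_class scale (m + n) (formal_bilinear (@) p q)"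
  using UN_formal_bilinear[OF multilinear_pairing_append] by (simp add: tensor_append_def)

lemma pure_tensor_closed [simp, intro]:
  "length xs = n \<Longrightarrow> pure_tensor scale xs \<in> carrier (tensor_power scale n)"
  by (auto simp: pure_tensor_def carrier_tensor_power)

lemma mult_pure_tensor:
  "length xs = n \<Longrightarrow> length ys = n \<Longrightarrow>
    pure_tensor scale xs \<otimes>\<^bsub>tensor_power scale n\<^esub> pure_tensor scale ys =
    pure_tensor scale (map2 (*) xs ys)"
  by (simp add: pure_tensor_def mult_tensor_class)

lemma append_pure_tensor:
  "length xs = m \<Longrightarrow> length ys = n \<Longrightarrow>
    tensor_append scale m n (pure_tensor scale xs) (pure_tensor scale ys) =
    pure_tensor scale (xs @ ys)"
  by (auto simp add: pure_tensor_def append_tensor_class)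

lemma pure_tensor_add:
  "length us + length vs + 1 = n \<Longrightarrow>
    pure_tensor scale (us @ (x + y) # vs) =
    pure_tensor scale (us @ x # vs) \<oplus>\<^bsub>tensor_power scale n\<^esub> pure_tensor scale (us @ y # vs)"
  using add_relation[of us vs n x y]
  by (auto simp: pure_tensor_def add_tensor_class tensor_class_eq_iff diff_diff_eq)

lemma pure_tensor_scale:
  "length us + length vs + 1 = n \<Longrightarrow>
    pure_tensor scale (us @ scale c x # vs) =
    c \<odot>\<^bsub>tensor_power scale n\<^esub> pure_tensor scale (us @ x # vs)"
  using scale_relation[of us vs n c x]
  by (auto simp: pure_tensor_def smult_tensor_class tensor_class_eq_iff)

lemma tensor_add_closed [simp, intro]:
  "S \<in> carrier (tensor_power scale n) \<Longrightarrow> T \<in> carrier (tensor_power scale n) \<Longrightarrow>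
    S \<oplus>\<^bsub>tensor_power scale n\<^esub> T \<in> carrier (tensor_power scale n)"
  by (auto simp: carrier_tensor_power add_tensor_class)

lemma tensor_smult_closed [simp, intro]:
  "S \<in> carrier (tensor_power scale n) \<Longrightarrow>
    c \<odot>\<^bsub>tensor_power scale n\<^esub> S \<in> carrier (tensor_power scale n)"
  by (auto simp: carrier_tensor_power smult_tensor_class)

lemma tensor_mult_closed [simp, intro]:
  assumes "S \<in> carrier (tensor_power scale n)" "T \<in> carrier (tensor_power scale n)"
  shows "S \<otimes>\<^bsub>tensor_power scale n\<^esub> T \<in> carrier (tensor_power scale n)"
proof -
  have "formal_bilinear (map2 (*)) p q \<in> formal_power n"
    if "p \<in> formal_power n" "q \<in> formal_power n" for p q :: "'a list \<Rightarrow>\<^sub>0 'k"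
    by (rule formal_bilinear_formal_power[OF that]) simp
  with assms show ?thesis
    by (auto simp: carrier_tensor_power mult_tensor_class)
qed

lemma tensor_append_closed [simp, intro]:
  assumes "S \<in> carrier (tensor_power scale m)" "T \<in> carrier (tensor_power scale n)"
    and "k = m + n"
  shows "tensor_append scale m n S T \<in> carrier (tensor_power scale k)"
proof -
  have "formal_bilinear (@) p q \<in> formal_power (m + n)"
    if "p \<in> formal_power m" "q \<in> formal_power n" for p q :: "'a list \<Rightarrow>\<^sub>0 'k"
    by (rule formal_bilinear_formal_power[OF that]) simp
  with assms show ?thesis
    by (auto simp: carrier_tensor_power append_tensor_class)
qed

lemma tensor_smult_add_left:
  "S \<in> carrier (tensor_power scale n) \<Longrightarrow>
    (c + d) \<odot>\<^bsub>tensor_power scale n\<^esub> S =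
    c \<odot>\<^bsub>tensor_power scale n\<^esub> S \<oplus>\<^bsub>tensor_power scale n\<^esub> d \<odot>\<^bsub>tensor_power scale n\<^esub> S"
  by (auto simp: carrier_tensor_power smult_tensor_class add_tensor_class
      formal.scale_left_distrib)

lemma tensor_smult_add_right:
  "S \<in> carrier (tensor_power scale n) \<Longrightarrow> T \<in> carrier (tensor_power scale n) \<Longrightarrow>
    c \<odot>\<^bsub>tensor_power scale n\<^esub> (S \<oplus>\<^bsub>tensor_power scale n\<^esub> T) =
    c \<odot>\<^bsub>tensor_power scale n\<^esub> S \<oplus>\<^bsub>tensor_power scale n\<^esub> c \<odot>\<^bsub>tensor_power scale n\<^esub> T"
  by (auto simp: carrier_tensor_power smult_tensor_class add_tensor_class
      formal.scale_right_distrib)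

lemma tensor_smult_smult:
  "S \<in> carrier (tensor_power scale n) \<Longrightarrow>
    c \<odot>\<^bsub>tensor_power scale n\<^esub> (d \<odot>\<^bsub>tensor_power scale n\<^esub> S) = (c * d) \<odot>\<^bsub>tensor_power scale n\<^esub> S"
  by (auto simp: carrier_tensor_power smult_tensor_class)

lemma tensor_smult_one:
  "S \<in> carrier (tensor_power scale n) \<Longrightarrow> 1 \<odot>\<^bsub>tensor_power scale n\<^esub> S = S"
  by (auto simp: carrier_tensor_power smult_tensor_class)

lemma tensor_smult_zero:
  "S \<in> carrier (tensor_power scale n) \<Longrightarrow>
    0 \<odot>\<^bsub>tensor_power scale n\<^esub> S = \<zero>\<^bsub>tensor_power scale n\<^esub>"
  by (auto simp: carrier_tensor_power smult_tensor_class zero_tensor_power)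

lemma tensor_mult_add_left:
  "S \<in> carrier (tensor_power scale n) \<Longrightarrow> S' \<in> carrier (tensor_power scale n) \<Longrightarrow>
    T \<in> carrier (tensor_power scale n) \<Longrightarrow>
    (S \<oplus>\<^bsub>tensor_power scale n\<^esub> S') \<otimes>\<^bsub>tensor_power scale n\<^esub> T =
    S \<otimes>\<^bsub>tensor_power scale n\<^esub> T \<oplus>\<^bsub>tensor_power scale n\<^esub> S' \<otimes>\<^bsub>tensor_power scale n\<^esub> T"
  by (auto simp: carrier_tensor_power mult_tensor_class add_tensor_class
      formal_bilinear_add_left)

lemma tensor_mult_add_right:
  "S \<in> carrier (tensor_power scale n) \<Longrightarrow> T \<in> carrier (tensor_power scale n) \<Longrightarrow>
    T' \<in> carrier (tensor_power scale n) \<Longrightarrow>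
    S \<otimes>\<^bsub>tensor_power scale n\<^esub> (T \<oplus>\<^bsub>tensor_power scale n\<^esub> T') =
    S \<otimes>\<^bsub>tensor_power scale n\<^esub> T \<oplus>\<^bsub>tensor_power scale n\<^esub> S \<otimes>\<^bsub>tensor_power scale n\<^esub> T'"
  by (auto simp: carrier_tensor_power mult_tensor_class add_tensor_class
      formal_bilinear_add_right)

lemma tensor_append_add_left:
  "S \<in> carrier (tensor_power scale m) \<Longrightarrow> S' \<in> carrier (tensor_power scale m) \<Longrightarrow>
    T \<in> carrier (tensor_power scale n) \<Longrightarrow> k = m + n \<Longrightarrow>
    tensor_append scale m n (S \<oplus>\<^bsub>tensor_power scale m\<^esub> S') T =
    tensor_append scale m n S T \<oplus>\<^bsub>tensor_power scale k\<^esub> tensor_append scale m n S' T"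
  by (auto simp: carrier_tensor_power append_tensor_class add_tensor_class
      formal_bilinear_add_left)

lemma tensor_append_add_right:
  "S \<in> carrier (tensor_power scale m) \<Longrightarrow> T \<in> carrier (tensor_power scale n) \<Longrightarrow>
    T' \<in> carrier (tensor_power scale n) \<Longrightarrow> k = m + n \<Longrightarrow>
    tensor_append scale m n S (T \<oplus>\<^bsub>tensor_power scale n\<^esub> T') =
    tensor_append scale m n S T \<oplus>\<^bsub>tensor_power scale k\<^esub> tensor_append scale m n S T'"
  by (auto simp: carrier_tensor_power append_tensor_class add_tensor_class
      formal_bilinear_add_right)

lemma tensor_append_smult_left:
  "S \<in> carrier (tensor_power scale m) \<Longrightarrow> T \<in> carrier (tensor_power scale n) \<Longrightarrow> k = m + n \<Longrightarrow>
    tensor_append scale m n (c \<odot>\<^bsub>tensor_power scale m\<^esub> S) T =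
    c \<odot>\<^bsub>tensor_power scale k\<^esub> tensor_append scale m n S T"
  by (auto simp: carrier_tensor_power append_tensor_class smult_tensor_class
      formal_bilinear_scale_left)

lemma tensor_append_smult_right:
  "S \<in> carrier (tensor_power scale m) \<Longrightarrow> T \<in> carrier (tensor_power scale n) \<Longrightarrow> k = m + n \<Longrightarrow>
    tensor_append scale m n S (c \<odot>\<^bsub>tensor_power scale n\<^esub> T) =
    c \<odot>\<^bsub>tensor_power scale k\<^esub> tensor_append scale m n S T"
  by (auto simp: carrier_tensor_power append_tensor_class smult_tensor_class
      formal_bilinear_scale_right)

text \<open>Scalars get no case of their own, because a coefficient can be absorbed into the first
  factor of a pure tensor. This is where \<open>0 < n\<close> enters.\<close>

lemma tensor_induct [consumes 2, case_names pure add]: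
  assumes T: "T \<in> carrier (tensor_power scale n)" and n: "0 < n"
    and pure: "\<And>xs. length xs = n \<Longrightarrow> P (pure_tensor scale xs)"
    and add: "\<And>S T. S \<in> carrier (tensor_power scale n) \<Longrightarrow> T \<in> carrier (tensor_power scale n) \<Longrightarrow>
      P S \<Longrightarrow> P T \<Longrightarrow> P (S \<oplus>\<^bsub>tensor_power scale n\<^esub> T)"
  shows "P T"
proof -
  have single: "tensor_class scale n (formal_scale c (Poly_Mapping.single xs 1)) =
      pure_tensor scale (scale c (hd xs) # tl xs)" if "length xs = n" for c xs
    using pure_tensor_scale[of "[]" "tl xs" n c "hd xs"] that n
    by (cases xs) (simp_all add: smult_tensor_class pure_tensor_def)
  have P_single: "P (tensor_class scale n (formal_scale c (Poly_Mapping.single xs 1)))"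
    if "length xs = n" for c xs
    unfolding single[OF that] using that n by (intro pure) auto
  \<comment> \<open>The coefficient \<open>0\<close> turns any list of length \<open>n\<close> into
    the zero combination; the constant list is one choice.\<close>
  have P_zero: "P (tensor_class scale n 0)"
    using P_single[of "replicate n 0" 0] by simp
  have P_sum: "P (tensor_class scale n (\<Sum>xs\<in>A. formal_scale (c xs) (Poly_Mapping.single xs 1)))"
    if "finite A" "\<forall>xs\<in>A. length xs = n" for A c
    using that
  proof (induction A rule: finite_induct)
    case (insert xs A)
    have "(\<Sum>xs\<in>A. formal_scale (c xs) (Poly_Mapping.single xs 1)) \<in> formal_power n"
      using insert.prems
      by (intro formal.subspace_sum[OF subspace_formal_power]) simp
    with insert show ?case
      using add[OF _ _ P_single[of xs "c xs"] insert.IH]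
      by (simp add: add_tensor_class carrier_tensor_power del: formal_scale_single)
  qed (simp add: P_zero)
  obtain p where p: "p \<in> formal_power n" "T = tensor_class scale n p"
    using T by (auto simp: carrier_tensor_power)
  have "P (tensor_class scale n p)"
    using P_sum[of "Poly_Mapping.keys p" "Poly_Mapping.lookup p"] p(1)
    by (simp only: formal_eq_sum[symmetric] formal_power_def mem_Collect_eq finite_keys)
  then show ?thesis
    by (simp only: p)
qed

lemmas tensor_induct_2 =
  tensor_induct[where n = 2, OF _ zero_less_numeral, consumes 1, case_names pure add]

section \<open>The ring structure of the tensor powers\<close>

lemma abelian_group_tensor_power: "abelian_group (tensor_power scale n)"
proof (rule abelian_groupI)
  fix S assume "S \<in> carrier (tensor_power scale n)"
  then obtain p where p: "p \<in> formal_power n" "S = tensor_class scale n p"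
    by (auto simp: carrier_tensor_power)
  then have "-p \<in> formal_power n"
    using formal.subspace_neg[OF subspace_formal_power] by blast
  with p show "\<exists>T\<in>carrier (tensor_power scale n).
      T \<oplus>\<^bsub>tensor_power scale n\<^esub> S = \<zero>\<^bsub>tensor_power scale n\<^esub>"
    by (intro bexI[of _ "tensor_class scale n (-p)"])
      (auto simp: carrier_tensor_power add_tensor_class zero_tensor_power)
qed (auto simp: carrier_tensor_power add_tensor_class zero_tensor_power add_ac)

lemma map2_mult_assoc:
  fixes xs ys zs :: "'b::semigroup_mult list"
  shows "map2 (*) (map2 (*) xs ys) zs = map2 (*) xs (map2 (*) ys zs)"
  by (rule nth_equalityI) (simp_all add: mult.assoc)

lemma map2_mult_one:
  fixes xs :: "'b::monoid_mult list"
  shows "map2 (*) (replicate (length xs) 1) xs = xs" "map2 (*) xs (replicate (length xs) 1) = xs"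
  by (auto intro: nth_equalityI)

text \<open>Both sides of the associativity and unit laws are additive in every argument, so
  \<open>tensor_induct\<close> reduces these laws to pure tensors, where they hold entry by
  entry.\<close>

lemma ring_tensor_power:
  assumes n: "0 < n"
  shows "ring (tensor_power scale n)"
proof (rule ringI[OF abelian_group_tensor_power monoidI tensor_mult_add_left tensor_mult_add_right])
  show "\<one>\<^bsub>tensor_power scale n\<^esub> \<in> carrier (tensor_power scale n)"
    by (simp add: one_tensor_power)
next
  fix S T U
  assume T: "T \<in> carrier (tensor_power scale n)" and U: "U \<in> carrier (tensor_power scale n)"
  assume "S \<in> carrier (tensor_power scale n)"
  from this n show "S \<otimes>\<^bsub>tensor_power scale n\<^esub> T \<otimes>\<^bsub>tensor_power scale n\<^esub> U =
      S \<otimes>\<^bsub>tensor_power scale n\<^esub> (T \<otimes>\<^bsub>tensor_power scale n\<^esub> U)"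
  proof (induction S rule: tensor_induct)
    case (pure xs)
    from T n show ?case
    proof (induction T rule: tensor_induct)
      case (pure ys)
      from U n show ?case
        by (induction U rule: tensor_induct)
          (use \<open>length xs = n\<close> pure in
            \<open>simp_all add: mult_pure_tensor map2_mult_assoc tensor_mult_add_right\<close>)
    qed (use U pure in \<open>simp_all add: tensor_mult_add_left tensor_mult_add_right\<close>)
  qed (use T U in \<open>simp_all add: tensor_mult_add_left\<close>)
next
  fix S assume "S \<in> carrier (tensor_power scale n)"
  from this n show "\<one>\<^bsub>tensor_power scale n\<^esub> \<otimes>\<^bsub>tensor_power scale n\<^esub> S = S"
  proof (induction S rule: tensor_induct)
    case (pure xs)
    then show ?case
      using map2_mult_one(1)[of xs] by (simp add: one_tensor_power mult_pure_tensor)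
  qed (simp_all add: one_tensor_power tensor_mult_add_right)
next
  fix S assume "S \<in> carrier (tensor_power scale n)"
  from this n show "S \<otimes>\<^bsub>tensor_power scale n\<^esub> \<one>\<^bsub>tensor_power scale n\<^esub> = S"
  proof (induction S rule: tensor_induct)
    case (pure xs)
    then show ?case
      using map2_mult_one(2)[of xs] by (simp add: one_tensor_power mult_pure_tensor)
  qed (simp_all add: one_tensor_power tensor_mult_add_left)
qed auto

text \<open>Both sides are additive in each of the four tensors, hence the four nested inductions.
  On pure tensors the cut between the two blocks lies at position \<open>m\<close> in both lists, so
  the entrywise product respects it.\<close>

lemma tensor_append_mult:
  assumes mn: "0 < m" "0 < n" "k = m + n"
    and S: "S \<in> carrier (tensor_power scale m)" and S': "S' \<in> carrier (tensor_power scale m)"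
    and T: "T \<in> carrier (tensor_power scale n)" and T': "T' \<in> carrier (tensor_power scale n)"
  shows "tensor_append scale m n S T \<otimes>\<^bsub>tensor_power scale k\<^esub> tensor_append scale m n S' T' =
    tensor_append scale m n (S \<otimes>\<^bsub>tensor_power scale m\<^esub> S') (T \<otimes>\<^bsub>tensor_power scale n\<^esub> T')"
  using S mn(1)
proof (induction S rule: tensor_induct)
  case (pure xs)
  from T mn(2) show ?case
  proof (induction T rule: tensor_induct)
    case (pure ys)
    from S' mn(1) show ?case
    proof (induction S' rule: tensor_induct)
      case (pure xs')
      from T' mn(2) show ?case
      proof (induction T' rule: tensor_induct)
        case (pure ys')
        then show ?case
          using \<open>length xs = m\<close> \<open>length ys = n\<close> \<open>length xs' = m\<close> mn(3)
          by (simp add: append_pure_tensor mult_pure_tensor)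
      qed (use \<open>length xs = m\<close> \<open>length ys = n\<close> pure mn(3) in
          \<open>simp_all add: tensor_append_add_right[of _ m _ n] tensor_mult_add_right\<close>)
    qed (use T' \<open>length xs = m\<close> pure mn(3) in
        \<open>simp_all add: tensor_append_add_left[of _ m _ _ n] tensor_mult_add_right\<close>)
  qed (use S' T' pure mn(3) in
      \<open>simp_all add: tensor_append_add_right[of _ m _ n] tensor_mult_add_left\<close>)
qed (use T S' T' mn(3) in
    \<open>simp_all add: tensor_append_add_left[of _ m _ _ n] tensor_mult_add_left\<close>)


section \<open>Maps induced by multilinear maps\<close>

text \<open>Values in the carrier are required on lists of every length, so that the sum in
  \<open>formal_lift\<close> is well behaved for all formal combinations. Multilinearity is asked
  only in length \<open>n\<close>.\<close>

definition multilinear_map :: "nat \<Rightarrow> nat \<Rightarrow> ('a list \<Rightarrow> ('k, 'a) tensor) \<Rightarrow> bool" where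
  "multilinear_map n k f \<longleftrightarrow>
    f \<in> UNIV \<rightarrow> carrier (tensor_power scale k) \<and>
    (\<forall>us vs x y. length us + length vs + 1 = n \<longrightarrow>
      f (us @ (x + y) # vs) = f (us @ x # vs) \<oplus>\<^bsub>tensor_power scale k\<^esub> f (us @ y # vs)) \<and>
    (\<forall>us vs c x. length us + length vs + 1 = n \<longrightarrow>
      f (us @ scale c x # vs) = c \<odot>\<^bsub>tensor_power scale k\<^esub> f (us @ x # vs))"

text \<open>The sum inside the definite description of \<open>tensor_lift\<close>, isolated so that
  its linearity is available before independence of the representative is known.\<close>

definition formal_lift ::
    "nat \<Rightarrow> ('a list \<Rightarrow> ('k, 'a) tensor) \<Rightarrow> ('a list \<Rightarrow>\<^sub>0 'k) \<Rightarrow> ('k, 'a) tensor" where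
  "formal_lift k f p = (\<Oplus>\<^bsub>tensor_power scale k\<^esub>xs\<in>Poly_Mapping.keys p.
    Poly_Mapping.lookup p xs \<odot>\<^bsub>tensor_power scale k\<^esub> f xs)"

lemma formal_lift_superset:
  assumes f: "f \<in> UNIV \<rightarrow> carrier (tensor_power scale k)"
    and A: "finite A" "Poly_Mapping.keys p \<subseteq> A"
  shows "formal_lift k f p = (\<Oplus>\<^bsub>tensor_power scale k\<^esub>xs\<in>A.
    Poly_Mapping.lookup p xs \<odot>\<^bsub>tensor_power scale k\<^esub> f xs)"
proof -
  interpret T: abelian_group "tensor_power scale k" by (rule abelian_group_tensor_power)
  show ?thesis
    unfolding formal_lift_def using A f
    by (intro T.add.finprod_mono_neutral_cong_left) (auto simp: in_keys_iff tensor_smult_zero Pi_iff)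
qed

lemma formal_lift_closed:
  assumes f: "f \<in> UNIV \<rightarrow> carrier (tensor_power scale k)"
  shows "formal_lift k f p \<in> carrier (tensor_power scale k)"
proof -
  interpret T: abelian_group "tensor_power scale k" by (rule abelian_group_tensor_power)
  show ?thesis
    unfolding formal_lift_def using f by (intro T.finsum_closed) auto
qed

lemma formal_lift_add:
  assumes f: "f \<in> UNIV \<rightarrow> carrier (tensor_power scale k)"
  shows "formal_lift k f (p + q) = formal_lift k f p \<oplus>\<^bsub>tensor_power scale k\<^esub> formal_lift k f q"
proof -
  interpret T: abelian_group "tensor_power scale k" by (rule abelian_group_tensor_power)
  let ?A = "Poly_Mapping.keys p \<union> Poly_Mapping.keys q"
  have "Poly_Mapping.keys (p + q) \<subseteq> ?A" by (rule Poly_Mapping.keys_add)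
  then show ?thesis
    using f by (simp add: Pi_iff formal_lift_superset[OF f, of ?A] lookup_add tensor_smult_add_left
        T.finsum_addf Pi_iff)
qed

lemma smult_finsum:
  assumes f: "\<And>x. x \<in> A \<Longrightarrow> f x \<in> carrier (tensor_power scale k)" and "finite A"
  shows "c \<odot>\<^bsub>tensor_power scale k\<^esub> (\<Oplus>\<^bsub>tensor_power scale k\<^esub>x\<in>A. f x) =
    (\<Oplus>\<^bsub>tensor_power scale k\<^esub>x\<in>A. c \<odot>\<^bsub>tensor_power scale k\<^esub> f x)"
proof -
  interpret T: abelian_group "tensor_power scale k" by (rule abelian_group_tensor_power)
  show ?thesis
    using \<open>finite A\<close> f
  proof (induction A rule: finite_induct)
    case empty
    show ?case by (simp add: zero_tensor_power smult_tensor_class)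
  next
    case (insert x A)
    then show ?case
      by (simp add: T.finsum_insert Pi_def tensor_smult_add_right T.finsum_closed)
  qed
qed

lemma formal_lift_scale:
  assumes f: "f \<in> UNIV \<rightarrow> carrier (tensor_power scale k)"
  shows "formal_lift k f (formal_scale c p) = c \<odot>\<^bsub>tensor_power scale k\<^esub> formal_lift k f p"
proof -
  interpret T: abelian_group "tensor_power scale k" by (rule abelian_group_tensor_power)
  show ?thesis
    using f by (simp add: Pi_iff formal_lift_superset[OF f, of "Poly_Mapping.keys p"] keys_formal_scale
        smult_finsum tensor_smult_smult Pi_iff)
qed

lemma formal_lift_single:
  assumes f: "f \<in> UNIV \<rightarrow> carrier (tensor_power scale k)"
  shows "formal_lift k f (Poly_Mapping.single xs 1) = f xs"
proof -
  interpret T: abelian_group "tensor_power scale k" by (rule abelian_group_tensor_power)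
  show ?thesis
    using f by (simp add: formal_lift_def tensor_smult_one Pi_iff)
qed

text \<open>This makes the induced map well defined. The kernel is a subspace, so it suffices that
  multilinearity of \<open>f\<close> kills each generating relation.\<close>

lemma formal_lift_relation_span:
  assumes f: "multilinear_map n k f" and r: "r \<in> relation_span n"
  shows "formal_lift k f r = \<zero>\<^bsub>tensor_power scale k\<^esub>"
proof -
  interpret T: abelian_group "tensor_power scale k" by (rule abelian_group_tensor_power)
  have closed: "f \<in> UNIV \<rightarrow> carrier (tensor_power scale k)"
    using f by (simp add: multilinear_map_def)
  note lift_simps = formal_lift_add[OF closed] formal_lift_scale[OF closed]
    formal_lift_single[OF closed] formal_lift_closed[OF closed]
  \<comment> \<open>Additivity on \<open>(p - q) + q\<close> gives the value at \<open>p\<close>;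
    cancelling the common value leaves zero.\<close>
  have cancel: "formal_lift k f (p - q) = \<zero>\<^bsub>tensor_power scale k\<^esub>"
    if "formal_lift k f p = formal_lift k f q" for p q
    using that lift_simps(1)[of "p - q" q] T.add.r_cancel_one[OF lift_simps(4) lift_simps(4)]
    by (metis diff_add_cancel)
  show ?thesis
    using r
  proof (induction r rule: formal.span_induct)
    case base
    show ?case
      by (rule formal.subspaceI)
        (simp_all add: lift_simps formal_lift_def[of _ _ 0] zero_tensor_power smult_tensor_class
          add_tensor_class)
  next
    case (step r)
    then show ?case
      unfolding multilinear_relations_def
    proof (elim UnE CollectE exE conjE)
      fix us vs x y
      assume r: "r = Poly_Mapping.single (us @ (x + y) # vs) 1
         - Poly_Mapping.single (us @ x # vs) 1 - Poly_Mapping.single (us @ y # vs) 1"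
        and l: "length us + length vs + 1 = n"
      show ?thesis
        \<comment> \<open>The two subtractions are gathered into one difference, so that
          \<open>cancel\<close> applies.\<close>
        unfolding r diff_diff_eq
        by (rule cancel) (use f l in \<open>simp add: lift_simps multilinear_map_def\<close>)
    next
      fix us vs c x
      assume r: "r = Poly_Mapping.single (us @ scale c x # vs) 1
         - formal_scale c (Poly_Mapping.single (us @ x # vs) 1)"
        and l: "length us + length vs + 1 = n"
      show ?thesis
        unfolding r
        by (rule cancel)
          (use f l in \<open>simp add: lift_simps multilinear_map_def del: formal_scale_single\<close>)
    qed
  qed
qed

text \<open>Two representatives differ by an element of the relation space, which the formal lift
  kills. Their common value is thus the unique witness of the definite description.\<close>

lemma tensor_lift_class:
  assumes f: "multilinear_map n k f"
  shows "tensor_lift (tensor_power scale k) f (tensor_class scale n p) = formal_lift k f p"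
proof -
  interpret T: abelian_group "tensor_power scale k" by (rule abelian_group_tensor_power)
  have closed: "f \<in> UNIV \<rightarrow> carrier (tensor_power scale k)"
    using f by (simp add: multilinear_map_def)
  have "formal_lift k f p' = formal_lift k f p" if "p' \<in> tensor_class scale n p" for p'
    using that formal_lift_add[OF closed, of "p' - p" p] formal_lift_closed[OF closed, of p]
    by (simp add: mem_tensor_class formal_lift_relation_span[OF f])
  note lift_const = this
  show ?thesis
    unfolding tensor_lift_def formal_lift_def[symmetric]
  proof (rule the_equality)
    show "\<forall>p'\<in>tensor_class scale n p. formal_lift k f p = formal_lift k f p'"
      using lift_const by metis
    show "y = formal_lift k f p" if "\<forall>p'\<in>tensor_class scale n p. y = formal_lift k f p'" for y
      using that tensor_class_self by blast
  qed
qed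

lemma tensor_lift_closed:
  assumes f: "multilinear_map n k f" and T: "T \<in> carrier (tensor_power scale n)"
  shows "tensor_lift (tensor_power scale k) f T \<in> carrier (tensor_power scale k)"
proof -
  obtain p where "T = tensor_class scale n p"
    using T by (auto simp: carrier_tensor_power)
  then show ?thesis
    using f tensor_lift_class[OF f] by (simp add: formal_lift_closed multilinear_map_def)
qed

lemma tensor_lift_add:
  assumes f: "multilinear_map n k f"
    and S: "S \<in> carrier (tensor_power scale n)" and T: "T \<in> carrier (tensor_power scale n)"
  shows "tensor_lift (tensor_power scale k) f (S \<oplus>\<^bsub>tensor_power scale n\<^esub> T) =
    tensor_lift (tensor_power scale k) f S \<oplus>\<^bsub>tensor_power scale k\<^esub>
    tensor_lift (tensor_power scale k) f T"
proof -
  obtain p q where "S = tensor_class scale n p" "T = tensor_class scale n q"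
    using S T by (auto simp: carrier_tensor_power)
  then show ?thesis
    using f tensor_lift_class[OF f]
    by (simp add: add_tensor_class formal_lift_add multilinear_map_def)
qed

lemma tensor_lift_pure:
  assumes f: "multilinear_map n k f" and "length xs = n"
  shows "tensor_lift (tensor_power scale k) f (pure_tensor scale xs) = f xs"
  using assms tensor_lift_class[OF f]
  by (simp add: pure_tensor_def formal_lift_single multilinear_map_def)

lemma multilinear_map_2I:
  assumes "\<And>xs. f xs \<in> carrier (tensor_power scale k)"
    and "\<And>x x' y. f [x + x', y] = f [x, y] \<oplus>\<^bsub>tensor_power scale k\<^esub> f [x', y]"
    and "\<And>x y y'. f [x, y + y'] = f [x, y] \<oplus>\<^bsub>tensor_power scale k\<^esub> f [x, y']"
    and "\<And>c x y. f [scale c x, y] = c \<odot>\<^bsub>tensor_power scale k\<^esub> f [x, y]"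
    and "\<And>c x y. f [x, scale c y] = c \<odot>\<^bsub>tensor_power scale k\<^esub> f [x, y]"
  shows "multilinear_map 2 k f"
proof -
  \<comment> \<open>The varied slot of a list of length 2 is the first or the second, so the
    quantification over \<open>us\<close> and \<open>vs\<close> becomes two explicit cases.\<close>
  have "us = [] \<and> (\<exists>b. vs = [b]) \<or> (\<exists>a. us = [a]) \<and> vs = []"
    if "length us + length vs + 1 = 2" for us vs :: "'a list"
    using that by (cases us; cases vs) auto
  note cases = this
  show ?thesis
    unfolding multilinear_map_def
    by (intro conjI allI impI; (drule cases)?) (use assms in auto)
qed

lemma multilinear_map_3I:
  assumes "\<And>xs. f xs \<in> carrier (tensor_power scale k)"
    and "\<And>x x' y z. f [x + x', y, z] = f [x, y, z] \<oplus>\<^bsub>tensor_power scale k\<^esub> f [x', y, z]"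
    and "\<And>x y y' z. f [x, y + y', z] = f [x, y, z] \<oplus>\<^bsub>tensor_power scale k\<^esub> f [x, y', z]"
    and "\<And>x y z z'. f [x, y, z + z'] = f [x, y, z] \<oplus>\<^bsub>tensor_power scale k\<^esub> f [x, y, z']"
    and "\<And>c x y z. f [scale c x, y, z] = c \<odot>\<^bsub>tensor_power scale k\<^esub> f [x, y, z]"
    and "\<And>c x y z. f [x, scale c y, z] = c \<odot>\<^bsub>tensor_power scale k\<^esub> f [x, y, z]"
    and "\<And>c x y z. f [x, y, scale c z] = c \<odot>\<^bsub>tensor_power scale k\<^esub> f [x, y, z]"
  shows "multilinear_map 3 k f"
proof -
  have "us = [] \<and> (\<exists>b c. vs = [b, c]) \<or> (\<exists>a. us = [a]) \<and> (\<exists>b. vs = [b]) \<or> (\<exists>a b. us = [a, b]) \<and> vs = []"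
    if "length us + length vs + 1 = 3" for us vs :: "'a list"
    using that by (cases us; cases "tl us"; cases vs; cases "tl vs") auto
  note cases = this
  show ?thesis
    unfolding multilinear_map_def
    by (intro conjI allI impI; (drule cases)?) (use assms in auto)
qed

section \<open>Legs, flips and leg permutations in degrees 2 and 3\<close>

lemma pure_tensor_2_add:
  "pure_tensor scale [x + x', y] =
    pure_tensor scale [x, y] \<oplus>\<^bsub>tensor_power scale 2\<^esub> pure_tensor scale [x', y]"
  "pure_tensor scale [x, y + y'] =
    pure_tensor scale [x, y] \<oplus>\<^bsub>tensor_power scale 2\<^esub> pure_tensor scale [x, y']"
  using pure_tensor_add[of "[]" "[y]" 2] pure_tensor_add[of "[x]" "[]" 2] by simp_all

lemma pure_tensor_2_scale:
  "pure_tensor scale [scale c x, y] = c \<odot>\<^bsub>tensor_power scale 2\<^esub> pure_tensor scale [x, y]"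
  "pure_tensor scale [x, scale c y] = c \<odot>\<^bsub>tensor_power scale 2\<^esub> pure_tensor scale [x, y]"
  using pure_tensor_scale[of "[]" "[y]" 2] pure_tensor_scale[of "[x]" "[]" 2] by simp_all

lemma pure_tensor_3_add:
  "pure_tensor scale [x + x', y, z] =
    pure_tensor scale [x, y, z] \<oplus>\<^bsub>tensor_power scale 3\<^esub> pure_tensor scale [x', y, z]"
  "pure_tensor scale [x, y + y', z] =
    pure_tensor scale [x, y, z] \<oplus>\<^bsub>tensor_power scale 3\<^esub> pure_tensor scale [x, y', z]"
  "pure_tensor scale [x, y, z + z'] =
    pure_tensor scale [x, y, z] \<oplus>\<^bsub>tensor_power scale 3\<^esub> pure_tensor scale [x, y, z']"
  using pure_tensor_add[of "[]" "[y, z]" 3] pure_tensor_add[of "[x]" "[z]" 3]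
    pure_tensor_add[of "[x, y]" "[]" 3] by simp_all

lemma pure_tensor_3_scale:
  "pure_tensor scale [scale c x, y, z] = c \<odot>\<^bsub>tensor_power scale 3\<^esub> pure_tensor scale [x, y, z]"
  "pure_tensor scale [x, scale c y, z] = c \<odot>\<^bsub>tensor_power scale 3\<^esub> pure_tensor scale [x, y, z]"
  "pure_tensor scale [x, y, scale c z] = c \<odot>\<^bsub>tensor_power scale 3\<^esub> pure_tensor scale [x, y, z]"
  using pure_tensor_scale[of "[]" "[y, z]" 3] pure_tensor_scale[of "[x]" "[z]" 3]
    pure_tensor_scale[of "[x, y]" "[]" 3] by simp_all

text \<open>Together with \<open>swap23\<close> this permutes the subscripts of the leg notation.
  Applied to a coproduct it produces the opposite coproduct, which quasitriangularity expresses
  through \<open>R\<close>.\<close>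

definition swap12 :: "('k, 'a) tensor \<Rightarrow> ('k, 'a) tensor" where
  "swap12 = tensor_lift (tensor_power scale 3) (\<lambda>xs. pure_tensor scale [xs ! 1, xs ! 0, xs ! 2])"

definition swap23 :: "('k, 'a) tensor \<Rightarrow> ('k, 'a) tensor" where
  "swap23 = tensor_lift (tensor_power scale 3) (\<lambda>xs. pure_tensor scale [xs ! 0, xs ! 2, xs ! 1])"

lemma multilinear_leg13: "multilinear_map 2 3 (\<lambda>xs. pure_tensor scale [xs ! 0, 1, xs ! 1])"
  by (rule multilinear_map_2I) (simp_all add: pure_tensor_3_add pure_tensor_3_scale)

lemma multilinear_flip: "multilinear_map 2 2 (\<lambda>xs. pure_tensor scale [xs ! 1, xs ! 0])"
  by (rule multilinear_map_2I) (simp_all add: pure_tensor_2_add pure_tensor_2_scale)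

lemma multilinear_swap12: "multilinear_map 3 3 (\<lambda>xs. pure_tensor scale [xs ! 1, xs ! 0, xs ! 2])"
  by (rule multilinear_map_3I) (simp_all add: pure_tensor_3_add pure_tensor_3_scale)

lemma multilinear_swap23: "multilinear_map 3 3 (\<lambda>xs. pure_tensor scale [xs ! 0, xs ! 2, xs ! 1])"
  by (rule multilinear_map_3I) (simp_all add: pure_tensor_3_add pure_tensor_3_scale)

lemma leg12_pure: "leg12 scale (pure_tensor scale [x, y]) = pure_tensor scale [x, y, 1]"
  by (simp add: leg12_def append_pure_tensor)

lemma leg23_pure: "leg23 scale (pure_tensor scale [x, y]) = pure_tensor scale [1, x, y]"
  by (simp add: leg23_def append_pure_tensor)

lemma leg12_closed:
  "T \<in> carrier (tensor_power scale 2) \<Longrightarrow> leg12 scale T \<in> carrier (tensor_power scale 3)"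
  unfolding leg12_def by (intro tensor_append_closed) simp_all

lemma leg12_add:
  "S \<in> carrier (tensor_power scale 2) \<Longrightarrow> T \<in> carrier (tensor_power scale 2) \<Longrightarrow>
    leg12 scale (S \<oplus>\<^bsub>tensor_power scale 2\<^esub> T) =
    leg12 scale S \<oplus>\<^bsub>tensor_power scale 3\<^esub> leg12 scale T"
  unfolding leg12_def by (intro tensor_append_add_left) simp_all

lemma leg23_closed:
  "T \<in> carrier (tensor_power scale 2) \<Longrightarrow> leg23 scale T \<in> carrier (tensor_power scale 3)"
  unfolding leg23_def by (intro tensor_append_closed) simp_all

lemma leg23_add:
  "S \<in> carrier (tensor_power scale 2) \<Longrightarrow> T \<in> carrier (tensor_power scale 2) \<Longrightarrow>
    leg23 scale (S \<oplus>\<^bsub>tensor_power scale 2\<^esub> T) =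
    leg23 scale S \<oplus>\<^bsub>tensor_power scale 3\<^esub> leg23 scale T"
  unfolding leg23_def by (intro tensor_append_add_right) simp_all

lemma leg13_pure: "leg13 scale (pure_tensor scale [x, y]) = pure_tensor scale [x, 1, y]"
  using tensor_lift_pure[OF multilinear_leg13, of "[x, y]"] by (simp add: leg13_def)

lemma flip_pure: "tensor_flip scale (pure_tensor scale [x, y]) = pure_tensor scale [y, x]"
  using tensor_lift_pure[OF multilinear_flip, of "[x, y]"] by (simp add: tensor_flip_def)

lemma swap12_pure: "swap12 (pure_tensor scale [x, y, z]) = pure_tensor scale [y, x, z]"
  using tensor_lift_pure[OF multilinear_swap12, of "[x, y, z]"] by (simp add: swap12_def)

lemma swap23_pure: "swap23 (pure_tensor scale [x, y, z]) = pure_tensor scale [x, z, y]"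
  using tensor_lift_pure[OF multilinear_swap23, of "[x, y, z]"] by (simp add: swap23_def)

lemmas leg13_closed = tensor_lift_closed[OF multilinear_leg13, folded leg13_def]
lemmas leg13_add = tensor_lift_add[OF multilinear_leg13, folded leg13_def]
lemmas flip_closed = tensor_lift_closed[OF multilinear_flip, folded tensor_flip_def]
lemmas flip_add = tensor_lift_add[OF multilinear_flip, folded tensor_flip_def]
lemmas swap12_closed = tensor_lift_closed[OF multilinear_swap12, folded swap12_def]
lemmas swap12_add = tensor_lift_add[OF multilinear_swap12, folded swap12_def]
lemmas swap23_closed = tensor_lift_closed[OF multilinear_swap23, folded swap23_def]
lemmas swap23_add = tensor_lift_add[OF multilinear_swap23, folded swap23_def]

text \<open>Additivity reduces multiplicativity to pure tensors, so that each instance below is a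
  computation with explicit lists.\<close>

lemma tensor_ring_homI:
  assumes mk: "0 < m" "0 < k"
    and closed: "\<And>S. S \<in> carrier (tensor_power scale m) \<Longrightarrow> h S \<in> carrier (tensor_power scale k)"
    and add: "\<And>S T. S \<in> carrier (tensor_power scale m) \<Longrightarrow> T \<in> carrier (tensor_power scale m) \<Longrightarrow>
      h (S \<oplus>\<^bsub>tensor_power scale m\<^esub> T) = h S \<oplus>\<^bsub>tensor_power scale k\<^esub> h T"
    and mult: "\<And>xs ys. length xs = m \<Longrightarrow> length ys = m \<Longrightarrow>
      h (pure_tensor scale (map2 (*) xs ys)) =
      h (pure_tensor scale xs) \<otimes>\<^bsub>tensor_power scale k\<^esub> h (pure_tensor scale ys)"
    and one: "h (pure_tensor scale (replicate m 1)) = pure_tensor scale (replicate k 1)"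
  shows "h \<in> ring_hom (tensor_power scale m) (tensor_power scale k)"
proof (rule ring_hom_memI)
  fix S T
  assume T: "T \<in> carrier (tensor_power scale m)"
  assume "S \<in> carrier (tensor_power scale m)"
  from this mk(1) show "h (S \<otimes>\<^bsub>tensor_power scale m\<^esub> T) = h S \<otimes>\<^bsub>tensor_power scale k\<^esub> h T"
  proof (induction S rule: tensor_induct)
    case (pure xs)
    from T mk(1) show ?case
    proof (induction T rule: tensor_induct)
      case (pure ys)
      show ?case
        using mult[OF \<open>length xs = m\<close> pure]
        by (simp only: mult_pure_tensor[OF \<open>length xs = m\<close> pure])
    qed (use pure in \<open>simp_all add: add closed tensor_mult_add_right\<close>)
  qed (use T in \<open>simp_all add: add closed tensor_mult_add_left\<close>)
next
  show "h \<one>\<^bsub>tensor_power scale m\<^esub> = \<one>\<^bsub>tensor_power scale k\<^esub>"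
    by (simp only: one_tensor_power one)
qed (fact closed add)+

lemma length_2_E:
  assumes "length xs = 2"
  obtains x y where "xs = [x, y]"
  using assms by (auto simp: numeral_2_eq_2 length_Suc_conv)

lemma length_3_E:
  assumes "length xs = 3"
  obtains x y z where "xs = [x, y, z]"
  using assms by (auto simp: numeral_3_eq_3 length_Suc_conv)

lemma ring_hom_leg12: "leg12 scale \<in> ring_hom (tensor_power scale 2) (tensor_power scale 3)"
proof (rule tensor_ring_homI)
  show "leg12 scale (pure_tensor scale (replicate 2 1)) = pure_tensor scale (replicate 3 1)"
    using leg12_pure[of 1 1] by (simp add: numeral_2_eq_2 numeral_3_eq_3)
qed (auto elim!: length_2_E simp: leg12_pure mult_pure_tensor leg12_closed leg12_add)

lemma ring_hom_leg23: "leg23 scale \<in> ring_hom (tensor_power scale 2) (tensor_power scale 3)"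
proof (rule tensor_ring_homI)
  show "leg23 scale (pure_tensor scale (replicate 2 1)) = pure_tensor scale (replicate 3 1)"
    using leg23_pure[of 1 1] by (simp add: numeral_2_eq_2 numeral_3_eq_3)
qed (auto elim!: length_2_E simp: leg23_pure mult_pure_tensor leg23_closed leg23_add)

lemma ring_hom_leg13: "leg13 scale \<in> ring_hom (tensor_power scale 2) (tensor_power scale 3)"
proof (rule tensor_ring_homI)
  show "leg13 scale (pure_tensor scale (replicate 2 1)) = pure_tensor scale (replicate 3 1)"
    using leg13_pure[of 1 1] by (simp add: numeral_2_eq_2 numeral_3_eq_3)
qed (auto elim!: length_2_E simp: leg13_pure mult_pure_tensor leg13_closed leg13_add)

lemma ring_hom_swap12: "swap12 \<in> ring_hom (tensor_power scale 3) (tensor_power scale 3)"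
proof (rule tensor_ring_homI)
  show "swap12 (pure_tensor scale (replicate 3 1)) = pure_tensor scale (replicate 3 1)"
    using swap12_pure[of 1 1 1] by (simp add: numeral_3_eq_3)
qed (auto elim!: length_3_E simp: swap12_pure mult_pure_tensor swap12_closed swap12_add)

lemma ring_hom_swap23: "swap23 \<in> ring_hom (tensor_power scale 3) (tensor_power scale 3)"
proof (rule tensor_ring_homI)
  show "swap23 (pure_tensor scale (replicate 3 1)) = pure_tensor scale (replicate 3 1)"
    using swap23_pure[of 1 1 1] by (simp add: numeral_3_eq_3)
qed (auto elim!: length_3_E simp: swap23_pure mult_pure_tensor swap23_closed swap23_add)

text \<open>In this and the next three facts the two nontrivial factors keep their order, so only
  the subscripts change and no flip of \<open>T\<close> appears.\<close>

lemma swap12_leg13: "T \<in> carrier (tensor_power scale 2) \<Longrightarrow> swap12 (leg13 scale T) = leg23 scale T"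
  by (induction T rule: tensor_induct_2)
    (auto elim!: length_2_E simp: leg13_pure leg23_pure swap12_pure leg13_add leg23_add swap12_add
      leg13_closed)

lemma swap12_leg23: "T \<in> carrier (tensor_power scale 2) \<Longrightarrow> swap12 (leg23 scale T) = leg13 scale T"
  by (induction T rule: tensor_induct_2)
    (auto elim!: length_2_E simp: leg13_pure leg23_pure swap12_pure leg13_add leg23_add swap12_add
      leg23_closed)

lemma swap23_leg13: "T \<in> carrier (tensor_power scale 2) \<Longrightarrow> swap23 (leg13 scale T) = leg12 scale T"
  by (induction T rule: tensor_induct_2)
    (auto elim!: length_2_E simp: leg13_pure leg12_pure swap23_pure leg13_add leg12_add swap23_add
      leg13_closed)

lemma swap23_leg12: "T \<in> carrier (tensor_power scale 2) \<Longrightarrow> swap23 (leg12 scale T) = leg13 scale T"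
  by (induction T rule: tensor_induct_2)
    (auto elim!: length_2_E simp: leg13_pure leg12_pure swap23_pure leg13_add leg12_add swap23_add
      leg12_closed)

text \<open>For \<open>T = \<Delta> y\<close> this places the opposite coproduct in the last two
  legs, where \<open>R_comult_op\<close> applies.\<close>

lemma swap23_append:
  "T \<in> carrier (tensor_power scale 2) \<Longrightarrow>
    swap23 (tensor_append scale 1 2 (pure_tensor scale [x]) T) =
    tensor_append scale 1 2 (pure_tensor scale [x]) (tensor_flip scale T)"
proof (induction T rule: tensor_induct_2)
  case (pure xs)
  then obtain y z where "xs = [y, z]" by (rule length_2_E)
  then show ?case by (simp add: append_pure_tensor swap23_pure flip_pure)
next
  case (add S T)
  then show ?case
    by (simp add: tensor_append_add_right[where k = 3] flip_add flip_closed swap23_add)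
qed

lemma swap12_append:
  "T \<in> carrier (tensor_power scale 2) \<Longrightarrow>
    swap12 (tensor_append scale 2 1 T (pure_tensor scale [x])) =
    tensor_append scale 2 1 (tensor_flip scale T) (pure_tensor scale [x])"
proof (induction T rule: tensor_induct_2)
  case (pure xs)
  then obtain y z where "xs = [y, z]" by (rule length_2_E)
  then show ?case by (simp add: append_pure_tensor swap12_pure flip_pure)
next
  case (add S T)
  then show ?case
    by (simp add: tensor_append_add_left[where k = 3] flip_add flip_closed swap12_add)
qed

lemma pure_tensor_1_add:
  "pure_tensor scale [x + y] =
    pure_tensor scale [x] \<oplus>\<^bsub>tensor_power scale 1\<^esub> pure_tensor scale [y]"
  using pure_tensor_add[of "[]" "[]" 1] by simp

lemma pure_tensor_1_scale:
  "pure_tensor scale [scale c x] = c \<odot>\<^bsub>tensor_power scale 1\<^esub> pure_tensor scale [x]"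
  using pure_tensor_scale[of "[]" "[]" 1] by simp

end

section \<open>Quasitriangular bialgebras\<close>

context bialgebra
begin

lemma comult_closed [simp, intro]: "\<Delta> h \<in> carrier (tensor_power scale 2)"
  using ring_hom_closed[OF comult_hom] by (simp add: algebra_record_def)

lemma comult_add: "\<Delta> (g + h) = \<Delta> g \<oplus>\<^bsub>tensor_power scale 2\<^esub> \<Delta> h"
  using ring_hom_add[OF comult_hom] by (simp add: algebra_record_def)

text \<open>Linearity in the second slot is that of \<open>\<Delta>\<close>. This is what makes
  \<open>id_comult\<close> independent of the representative.\<close>

lemma multilinear_id_comult:
  "multilinear_map 2 3 (\<lambda>xs. tensor_append scale 1 2 (pure_tensor scale [xs ! 0]) (\<Delta> (xs ! 1)))"
  by (rule multilinear_map_2I)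
    (simp_all add: Pi_iff comult_add comult_scale
      pure_tensor_1_add[unfolded One_nat_def] pure_tensor_1_scale[unfolded One_nat_def]
      tensor_append_add_left[where k = 3] tensor_append_add_right[where k = 3]
      tensor_append_smult_left[where k = 3] tensor_append_smult_right[where k = 3])

lemma multilinear_comult_id:
  "multilinear_map 2 3 (\<lambda>xs. tensor_append scale 2 1 (\<Delta> (xs ! 0)) (pure_tensor scale [xs ! 1]))"
  by (rule multilinear_map_2I)
    (simp_all add: Pi_iff comult_add comult_scale
      pure_tensor_1_add[unfolded One_nat_def] pure_tensor_1_scale[unfolded One_nat_def]
      tensor_append_add_left[where k = 3] tensor_append_add_right[where k = 3]
      tensor_append_smult_left[where k = 3] tensor_append_smult_right[where k = 3])

lemmas id_comult_closed = tensor_lift_closed[OF multilinear_id_comult, folded id_comult_def]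
lemmas id_comult_add = tensor_lift_add[OF multilinear_id_comult, folded id_comult_def]
lemmas comult_id_closed = tensor_lift_closed[OF multilinear_comult_id, folded comult_id_def]
lemmas comult_id_add = tensor_lift_add[OF multilinear_comult_id, folded comult_id_def]

lemma id_comult_pure:
  "id_comult scale \<Delta> (pure_tensor scale [x, y]) =
    tensor_append scale 1 2 (pure_tensor scale [x]) (\<Delta> y)"
  using tensor_lift_pure[OF multilinear_id_comult, of "[x, y]"] by (simp add: id_comult_def)

lemma comult_id_pure:
  "comult_id scale \<Delta> (pure_tensor scale [x, y]) =
    tensor_append scale 2 1 (\<Delta> x) (pure_tensor scale [y])"
  using tensor_lift_pure[OF multilinear_comult_id, of "[x, y]"] by (simp add: comult_id_def)

text \<open>On a pure tensor with entries \<open>x\<close> and \<open>y\<close>, the factor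
  \<open>\<chi>\<close> meets \<open>\<Delta> x\<close> and the factor \<open>1\<close> meets
  \<open>y\<close>; both pairs commute. It is applied to \<open>T = R\<close>, where the coproduct
  becomes a product of two legs of \<open>R\<close>.\<close>

lemma leg12_commutes_comult_id:
  assumes \<chi>: "\<chi> \<in> carrier (tensor_power scale 2)" "commutes_with_comult scale \<Delta> \<chi>"
    and T: "T \<in> carrier (tensor_power scale 2)"
  shows "leg12 scale \<chi> \<otimes>\<^bsub>tensor_power scale 3\<^esub> comult_id scale \<Delta> T =
    comult_id scale \<Delta> T \<otimes>\<^bsub>tensor_power scale 3\<^esub> leg12 scale \<chi>"
  using T
proof (induction T rule: tensor_induct_2)
  case (pure xs)
  then obtain x y where xs: "xs = [x, y]" by (rule length_2_E)
  have "pure_tensor scale [1] \<otimes>\<^bsub>tensor_power scale 1\<^esub> pure_tensor scale [y] = pure_tensor scale [y]"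
    "pure_tensor scale [y] \<otimes>\<^bsub>tensor_power scale 1\<^esub> pure_tensor scale [1] = pure_tensor scale [y]"
    by (simp_all add: mult_pure_tensor)
  moreover have "\<chi> \<otimes>\<^bsub>tensor_power scale 2\<^esub> \<Delta> x = \<Delta> x \<otimes>\<^bsub>tensor_power scale 2\<^esub> \<chi>"
    using \<chi>(2) by (simp add: commutes_with_comult_def)
  ultimately show ?case
    using \<chi>(1) unfolding xs comult_id_pure leg12_def
    by (subst (1 2) tensor_append_mult) simp_all
next
  case (add S T)
  then show ?case
    by (simp add: comult_id_add comult_id_closed leg12_closed \<chi>(1) tensor_mult_add_left
        tensor_mult_add_right)
qed

text \<open>The mirror image: here \<open>\<chi>\<close> meets \<open>\<Delta> y\<close> in the last
  two legs, and \<open>1\<close> meets \<open>x\<close> in the first.\<close>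

lemma leg23_commutes_id_comult:
  assumes \<chi>: "\<chi> \<in> carrier (tensor_power scale 2)" "commutes_with_comult scale \<Delta> \<chi>"
    and T: "T \<in> carrier (tensor_power scale 2)"
  shows "leg23 scale \<chi> \<otimes>\<^bsub>tensor_power scale 3\<^esub> id_comult scale \<Delta> T =
    id_comult scale \<Delta> T \<otimes>\<^bsub>tensor_power scale 3\<^esub> leg23 scale \<chi>"
  using T
proof (induction T rule: tensor_induct_2)
  case (pure xs)
  then obtain x y where xs: "xs = [x, y]" by (rule length_2_E)
  have "pure_tensor scale [1] \<otimes>\<^bsub>tensor_power scale 1\<^esub> pure_tensor scale [x] = pure_tensor scale [x]"
    "pure_tensor scale [x] \<otimes>\<^bsub>tensor_power scale 1\<^esub> pure_tensor scale [1] = pure_tensor scale [x]"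
    by (simp_all add: mult_pure_tensor)
  moreover have "\<chi> \<otimes>\<^bsub>tensor_power scale 2\<^esub> \<Delta> y = \<Delta> y \<otimes>\<^bsub>tensor_power scale 2\<^esub> \<chi>"
    using \<chi>(2) by (simp add: commutes_with_comult_def)
  ultimately show ?case
    using \<chi>(1) unfolding xs id_comult_pure leg23_def
    by (subst (1 2) tensor_append_mult) simp_all
next
  case (add S T)
  then show ?case
    by (simp add: id_comult_add id_comult_closed leg23_closed \<chi>(1) tensor_mult_add_left
        tensor_mult_add_right)
qed

end

section \<open>Swapping the legs of a coproduct as conjugation by a leg of \<open>R\<close>\<close>

context quasitriangular_bialgebra
begin

lemma R_closed: "R \<in> carrier (tensor_power scale 2)"
  and inv_R_closed: "inv\<^bsub>tensor_power scale 2\<^esub> R \<in> carrier (tensor_power scale 2)"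
proof -
  interpret T: ring "tensor_power scale 2" by (rule ring_tensor_power) simp
  show "R \<in> carrier (tensor_power scale 2)" "inv\<^bsub>tensor_power scale 2\<^esub> R \<in> carrier (tensor_power scale 2)"
    using R_invertible by auto
qed

text \<open>The swap replaces \<open>\<Delta>\<close> by the opposite coproduct, which is
  \<open>\<Delta>\<close> conjugated by \<open>R\<close>. The inverse is kept inside the leg, so
  that all three factors are values of \<open>tensor_append\<close>.\<close>

lemma swap23_id_comult:
  assumes "T \<in> carrier (tensor_power scale 2)"
  shows "swap23 (id_comult scale \<Delta> T) =
    leg23 scale R \<otimes>\<^bsub>tensor_power scale 3\<^esub> id_comult scale \<Delta> T \<otimes>\<^bsub>tensor_power scale 3\<^esub>
    leg23 scale (inv\<^bsub>tensor_power scale 2\<^esub> R)"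
  using assms
proof (induction T rule: tensor_induct_2)
  case (pure xs)
  then obtain x y where xs: "xs = [x, y]" by (rule length_2_E)
  \<comment> \<open>Writing the first factor as \<open>1 x 1\<close> makes the whole expression a
    product of three appended tensors.\<close>
  have "pure_tensor scale [1] \<otimes>\<^bsub>tensor_power scale 1\<^esub> pure_tensor scale [x] = pure_tensor scale [x]"
    "pure_tensor scale [x] \<otimes>\<^bsub>tensor_power scale 1\<^esub> pure_tensor scale [1] = pure_tensor scale [x]"
    by (simp_all add: mult_pure_tensor)
  then show ?case
    unfolding xs id_comult_pure leg23_def swap23_append[OF comult_closed] R_comult_op
    using R_closed inv_R_closed by (subst tensor_append_mult, simp_all)+
next
  case (add S T)
  then show ?case
    by (simp add: id_comult_add id_comult_closed leg23_closed R_closed inv_R_closed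
        swap23_add tensor_mult_add_left tensor_mult_add_right)
qed

text \<open>The same argument with the opposite coproduct in the first two legs and the last factor
  written as \<open>1 y 1\<close>.\<close>

lemma swap12_comult_id:
  assumes "T \<in> carrier (tensor_power scale 2)"
  shows "swap12 (comult_id scale \<Delta> T) =
    leg12 scale R \<otimes>\<^bsub>tensor_power scale 3\<^esub> comult_id scale \<Delta> T \<otimes>\<^bsub>tensor_power scale 3\<^esub>
    leg12 scale (inv\<^bsub>tensor_power scale 2\<^esub> R)"
  using assms
proof (induction T rule: tensor_induct_2)
  case (pure xs)
  then obtain x y where xs: "xs = [x, y]" by (rule length_2_E)
  have "pure_tensor scale [1] \<otimes>\<^bsub>tensor_power scale 1\<^esub> pure_tensor scale [y] = pure_tensor scale [y]"
    "pure_tensor scale [y] \<otimes>\<^bsub>tensor_power scale 1\<^esub> pure_tensor scale [1] = pure_tensor scale [y]"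
    by (simp_all add: mult_pure_tensor)
  then show ?case
    unfolding xs comult_id_pure leg12_def swap12_append[OF comult_closed] R_comult_op
    using R_closed inv_R_closed by (subst tensor_append_mult, simp_all)+
next
  case (add S T)
  then show ?case
    by (simp add: comult_id_add comult_id_closed leg12_closed R_closed inv_R_closed
        swap12_add tensor_mult_add_left tensor_mult_add_right)
qed

end

section \<open>Two facts about units in rings\<close>

lemma ring_hom_Units:
  assumes "ring A" "ring B" and h: "h \<in> ring_hom A B" and x: "x \<in> Units A"
  shows "h x \<in> Units B" and "h (inv\<^bsub>A\<^esub> x) = inv\<^bsub>B\<^esub> h x"
proof -
  interpret A: ring A by fact
  interpret B: ring B by fact
  have 1: "h x \<in> carrier B" "h (inv\<^bsub>A\<^esub> x) \<in> carrier B"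
    using x by (auto intro: ring_hom_closed[OF h])
  have 2: "h x \<otimes>\<^bsub>B\<^esub> h (inv\<^bsub>A\<^esub> x) = \<one>\<^bsub>B\<^esub>" "h (inv\<^bsub>A\<^esub> x) \<otimes>\<^bsub>B\<^esub> h x = \<one>\<^bsub>B\<^esub>"
    using x A.Units_closed[OF x]
    by (simp_all add: ring_hom_mult[OF h, symmetric] ring_hom_one[OF h])
  show "h x \<in> Units B" using 1 2 by (auto simp: Units_def)
  show "h (inv\<^bsub>A\<^esub> x) = inv\<^bsub>B\<^esub> h x" using 1 2 by (rule B.inv_unique')
qed

text \<open>The noncommutative core, free of tensors. For the formula on
  \<open>(Id \<otimes> \<Delta>)(\<chi>)\<close> one reads
  \<open>a = \<chi>\<^sub>1\<^sub>2\<close>, \<open>b = \<chi>\<^sub>1\<^sub>3\<close>,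
  \<open>u = R\<^sub>1\<^sub>2\<close>, \<open>v = R\<^sub>1\<^sub>3\<close>,
  \<open>w = R\<^sub>2\<^sub>3\<close>. Then \<open>eq\<close> compares the two expressions for the
  swapped coproduct, and \<open>comm\<close> holds since \<open>v \<otimes> w\<close> is
  \<open>(\<Delta> \<otimes> Id)(R)\<close>.\<close>

lemma (in ring) conjugates_eq:
  assumes a: "a \<in> carrier R" and b: "b \<in> carrier R"
    and u: "u \<in> Units R" and v: "v \<in> Units R" and w: "w \<in> Units R"
    and eq: "b \<oplus> inv v \<otimes> a \<otimes> v = w \<otimes> (a \<oplus> inv u \<otimes> b \<otimes> u) \<otimes> inv w"
    and comm: "a \<otimes> (v \<otimes> w) = v \<otimes> w \<otimes> a"
  shows "inv u \<otimes> b \<otimes> u = inv w \<otimes> b \<otimes> w"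
proof -
  note [simp] = Units_closed[OF u] Units_closed[OF v] Units_closed[OF w]
    Units_inv_closed[OF u] Units_inv_closed[OF v] Units_inv_closed[OF w] a b
  define X where "X = a \<oplus> inv u \<otimes> b \<otimes> u"
  have [simp]: "X \<in> carrier R" by (simp add: X_def)
  \<comment> \<open>Inserting \<open>inv w \<otimes> w\<close> on both sides exposes the conjugate
    of \<open>X\<close> by \<open>w\<close>, which \<open>eq\<close> evaluates in a second
    way.\<close>
  have "X = inv w \<otimes> w \<otimes> X \<otimes> (inv w \<otimes> w)" using w by simp
  also have "\<dots> = inv w \<otimes> (w \<otimes> X \<otimes> inv w) \<otimes> w" by (simp add: m_assoc)
  also have "\<dots> = inv w \<otimes> (b \<oplus> inv v \<otimes> a \<otimes> v) \<otimes> w" by (simp add: eq X_def)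
  also have "\<dots> = inv w \<otimes> b \<otimes> w \<oplus> inv w \<otimes> inv v \<otimes> (a \<otimes> (v \<otimes> w))"
    by (simp add: l_distr r_distr m_assoc)
  \<comment> \<open>The element \<open>a\<close> moves to the right of \<open>v \<otimes> w\<close>
    by \<open>comm\<close>, after which all units cancel.\<close>
  also have "inv w \<otimes> inv v \<otimes> (a \<otimes> (v \<otimes> w)) = inv w \<otimes> (inv v \<otimes> v) \<otimes> w \<otimes> a"
    unfolding comm by (simp add: m_assoc)
  also have "\<dots> = a" using v w by simp
  \<comment> \<open>Both expressions for \<open>X\<close> contain the summand \<open>a\<close>, and
    cancelling it gives the claim.\<close>
  finally have "a \<oplus> inv u \<otimes> b \<otimes> u = a \<oplus> inv w \<otimes> b \<otimes> w"
    by (simp add: X_def a_comm)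
  then show ?thesis by simp
qed

section \<open>Equality of the two conjugates of the outer leg of \<chi>\<close>

context quasitriangular_bialgebra
begin

lemma conjugates_of_leg13:
  assumes \<chi>: "\<chi> \<in> carrier (tensor_power scale 2)"
    and comm: "commutes_with_comult scale \<Delta> \<chi>"
    and "id_comult_condition scale \<Delta> R \<chi> \<or> comult_id_condition scale \<Delta> R \<chi>"
  shows "inv\<^bsub>tensor_power scale 3\<^esub> (leg12 scale R) \<otimes>\<^bsub>tensor_power scale 3\<^esub> leg13 scale \<chi>
      \<otimes>\<^bsub>tensor_power scale 3\<^esub> leg12 scale R =
    inv\<^bsub>tensor_power scale 3\<^esub> (leg23 scale R) \<otimes>\<^bsub>tensor_power scale 3\<^esub> leg13 scale \<chi>
      \<otimes>\<^bsub>tensor_power scale 3\<^esub> leg23 scale R"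
proof -
  have T2: "ring (tensor_power scale 2)" by (rule ring_tensor_power) simp
  interpret T: ring "tensor_power scale 3" by (rule ring_tensor_power) simp
  note units = ring_hom_Units(1)[OF T2 T.ring_axioms _ R_invertible]
  note invs = ring_hom_Units(2)[OF T2 T.ring_axioms _ R_invertible]
  note units12 = units[OF ring_hom_leg12] and units13 = units[OF ring_hom_leg13]
    and units23 = units[OF ring_hom_leg23]
  note closed = leg12_closed leg13_closed leg23_closed \<chi> R_closed inv_R_closed
  show ?thesis
    using assms(3)
  proof
    assume "id_comult_condition scale \<Delta> R \<chi>"
    then have eq: "id_comult scale \<Delta> \<chi> = leg12 scale \<chi> \<oplus>\<^bsub>tensor_power scale 3\<^esub>
        (inv\<^bsub>tensor_power scale 3\<^esub> (leg12 scale R) \<otimes>\<^bsub>tensor_power scale 3\<^esub> leg13 scale \<chi>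
          \<otimes>\<^bsub>tensor_power scale 3\<^esub> leg12 scale R)"
      by (simp add: id_comult_condition_def)
    have "swap23 (id_comult scale \<Delta> \<chi>) = leg13 scale \<chi> \<oplus>\<^bsub>tensor_power scale 3\<^esub>
        (inv\<^bsub>tensor_power scale 3\<^esub> (leg13 scale R) \<otimes>\<^bsub>tensor_power scale 3\<^esub> leg12 scale \<chi>
          \<otimes>\<^bsub>tensor_power scale 3\<^esub> leg13 scale R)"
      \<comment> \<open>The inverse of a leg of \<open>R\<close> is rewritten as a leg of the
        inverse of \<open>R\<close>, because the effect of \<open>swap23\<close> is known on
        legs.\<close>
      unfolding eq invs[OF ring_hom_leg12, symmetric] invs[OF ring_hom_leg13, symmetric]
      by (simp add: ring_hom_mult[OF ring_hom_swap23] swap23_add closed swap23_leg12 swap23_leg13)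
    then show ?thesis
      \<comment> \<open>The two expressions for the swapped coproduct supply \<open>eq\<close>.
        Rewriting with \<open>R_comult_id\<close> turns the commutation with the coproduct of
        \<open>R\<close> into \<open>comm\<close>.\<close>
      using swap23_id_comult[OF \<chi>] leg12_commutes_comult_id[OF \<chi> comm R_closed]
      unfolding eq invs[OF ring_hom_leg23] R_comult_id
      by (intro T.conjugates_eq[where a = "leg12 scale \<chi>" and v = "leg13 scale R"])
        (simp_all add: closed units12 units13 units23)
  next
    assume "comult_id_condition scale \<Delta> R \<chi>"
    then have eq: "comult_id scale \<Delta> \<chi> = leg23 scale \<chi> \<oplus>\<^bsub>tensor_power scale 3\<^esub>
        (inv\<^bsub>tensor_power scale 3\<^esub> (leg23 scale R) \<otimes>\<^bsub>tensor_power scale 3\<^esub> leg13 scale \<chi>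
          \<otimes>\<^bsub>tensor_power scale 3\<^esub> leg23 scale R)"
      by (simp add: comult_id_condition_def)
    \<comment> \<open>The mirrored case: the first two legs are swapped, so that the subscripts 13
      and 23 are exchanged and \<open>R\<^sub>1\<^sub>2\<close> becomes the conjugating unit
      \<open>w\<close>.\<close>
    have "swap12 (comult_id scale \<Delta> \<chi>) = leg13 scale \<chi> \<oplus>\<^bsub>tensor_power scale 3\<^esub>
        (inv\<^bsub>tensor_power scale 3\<^esub> (leg13 scale R) \<otimes>\<^bsub>tensor_power scale 3\<^esub> leg23 scale \<chi>
          \<otimes>\<^bsub>tensor_power scale 3\<^esub> leg13 scale R)"
      unfolding eq invs[OF ring_hom_leg23, symmetric] invs[OF ring_hom_leg13, symmetric]
      by (simp add: ring_hom_mult[OF ring_hom_swap12] swap12_add closed swap12_leg23 swap12_leg13)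
    then show ?thesis
      using swap12_comult_id[OF \<chi>] leg23_commutes_id_comult[OF \<chi> comm R_closed]
      unfolding eq invs[OF ring_hom_leg12] R_id_comult
      \<comment> \<open>Now \<open>u = R\<^sub>2\<^sub>3\<close> and
        \<open>w = R\<^sub>1\<^sub>2\<close>, so the two conjugates come out in the opposite
        order.\<close>
      by (intro T.conjugates_eq[where a = "leg23 scale \<chi>" and v = "leg13 scale R", symmetric])
        (simp_all add: closed units12 units13 units23)
  qed
qed

end

section \<open>From the equality of the conjugates to the equivalence\<close>

theorem proposition3p1:
  fixes scale :: "'k::field \<Rightarrow> 'a::ring_1 \<Rightarrow> 'a"
    and \<Delta> :: "'a \<Rightarrow> ('k, 'a) tensor"
    and \<epsilon> :: "'a \<Rightarrow> 'k"
    and R \<chi> :: "('k, 'a) tensor"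
  assumes "quasitriangular_bialgebra scale \<Delta> \<epsilon> R"
    and "\<chi> \<in> carrier (tensor_power scale 2)"
  shows "infinitesimal_R_matrix scale \<Delta> R \<chi> \<longleftrightarrow>
    two_cocycle scale \<Delta> \<chi> \<and>
    commutes_with_comult scale \<Delta> \<chi> \<and>
    (id_comult_condition scale \<Delta> R \<chi> \<or> comult_id_condition scale \<Delta> R \<chi>)"
proof -
  interpret quasitriangular_bialgebra scale \<Delta> \<epsilon> R by fact
  interpret T: ring "tensor_power scale 3" by (rule ring_tensor_power) simp
  note \<chi> = assms(2)
  define A where "A = inv\<^bsub>tensor_power scale 3\<^esub> (leg12 scale R) \<otimes>\<^bsub>tensor_power scale 3\<^esub>
    leg13 scale \<chi> \<otimes>\<^bsub>tensor_power scale 3\<^esub> leg12 scale R"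
  define B where "B = inv\<^bsub>tensor_power scale 3\<^esub> (leg23 scale R) \<otimes>\<^bsub>tensor_power scale 3\<^esub>
    leg13 scale \<chi> \<otimes>\<^bsub>tensor_power scale 3\<^esub> leg23 scale R"
  have T2: "ring (tensor_power scale 2)" by (rule ring_tensor_power) simp
  note units = ring_hom_Units(1)[OF T2 T.ring_axioms _ R_invertible]
  have closed: "A \<in> carrier (tensor_power scale 3)" "leg12 scale \<chi> \<in> carrier (tensor_power scale 3)"
    "leg23 scale \<chi> \<in> carrier (tensor_power scale 3)"
    "id_comult scale \<Delta> \<chi> \<in> carrier (tensor_power scale 3)"
    "comult_id scale \<Delta> \<chi> \<in> carrier (tensor_power scale 3)"
    using \<chi> R_closed units[OF ring_hom_leg12]
    by (simp_all add: A_def leg12_closed leg13_closed leg23_closed id_comult_closed comult_id_closed)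
  have id_comult: "id_comult_condition scale \<Delta> R \<chi> \<longleftrightarrow>
      id_comult scale \<Delta> \<chi> = leg12 scale \<chi> \<oplus>\<^bsub>tensor_power scale 3\<^esub> A"
    by (simp add: id_comult_condition_def A_def)
  have comult_id: "comult_id_condition scale \<Delta> R \<chi> \<longleftrightarrow>
      comult_id scale \<Delta> \<chi> = leg23 scale \<chi> \<oplus>\<^bsub>tensor_power scale 3\<^esub> B"
    by (simp add: comult_id_condition_def B_def)
  \<comment> \<open>Either side of the theorem implies both \<open>comm\<close> and
    \<open>cond\<close>, so it is enough to compare the remaining conditions under these
    two.\<close>
  have "two_cocycle scale \<Delta> \<chi> \<longleftrightarrow>
      id_comult_condition scale \<Delta> R \<chi> \<and> comult_id_condition scale \<Delta> R \<chi>"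
    if comm: "commutes_with_comult scale \<Delta> \<chi>"
      and cond: "id_comult_condition scale \<Delta> R \<chi> \<or> comult_id_condition scale \<Delta> R \<chi>"
  proof -
    \<comment> \<open>From here on only commutativity and cancellation of addition are used.\<close>
    have AB: "B = A"
      unfolding A_def B_def by (rule conjugates_of_leg13[OF \<chi> comm cond, symmetric])
    show ?thesis
      using cond unfolding id_comult comult_id two_cocycle_def AB
    proof
      assume *: "id_comult scale \<Delta> \<chi> = leg12 scale \<chi> \<oplus>\<^bsub>tensor_power scale 3\<^esub> A"
      \<comment> \<open>With the known formula inserted, both sides of the cocycle equation have the
        summand \<open>leg12 scale \<chi>\<close>. Cancelling it leaves exactly the other coproduct
        formula.\<close>
      have "leg23 scale \<chi> \<oplus>\<^bsub>tensor_power scale 3\<^esub> id_comult scale \<Delta> \<chi> =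
          leg12 scale \<chi> \<oplus>\<^bsub>tensor_power scale 3\<^esub> (leg23 scale \<chi> \<oplus>\<^bsub>tensor_power scale 3\<^esub> A)"
        unfolding * using closed by (simp add: T.a_lcomm)
      then show "leg12 scale \<chi> \<oplus>\<^bsub>tensor_power scale 3\<^esub> comult_id scale \<Delta> \<chi> =
            leg23 scale \<chi> \<oplus>\<^bsub>tensor_power scale 3\<^esub> id_comult scale \<Delta> \<chi> \<longleftrightarrow>
          id_comult scale \<Delta> \<chi> = leg12 scale \<chi> \<oplus>\<^bsub>tensor_power scale 3\<^esub> A \<and>
          comult_id scale \<Delta> \<chi> = leg23 scale \<chi> \<oplus>\<^bsub>tensor_power scale 3\<^esub> A"
        using * closed by simp
    next
      assume *: "comult_id scale \<Delta> \<chi> = leg23 scale \<chi> \<oplus>\<^bsub>tensor_power scale 3\<^esub> A"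
      \<comment> \<open>Here the common summand of the cocycle equation is
        \<open>leg23 scale \<chi>\<close>.\<close>
      have "leg12 scale \<chi> \<oplus>\<^bsub>tensor_power scale 3\<^esub> comult_id scale \<Delta> \<chi> =
          leg23 scale \<chi> \<oplus>\<^bsub>tensor_power scale 3\<^esub> (leg12 scale \<chi> \<oplus>\<^bsub>tensor_power scale 3\<^esub> A)"
        unfolding * using closed by (simp add: T.a_lcomm)
      then show "leg12 scale \<chi> \<oplus>\<^bsub>tensor_power scale 3\<^esub> comult_id scale \<Delta> \<chi> =
            leg23 scale \<chi> \<oplus>\<^bsub>tensor_power scale 3\<^esub> id_comult scale \<Delta> \<chi> \<longleftrightarrow>
          id_comult scale \<Delta> \<chi> = leg12 scale \<chi> \<oplus>\<^bsub>tensor_power scale 3\<^esub> A \<and>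
          comult_id scale \<Delta> \<chi> = leg23 scale \<chi> \<oplus>\<^bsub>tensor_power scale 3\<^esub> A"
        using * closed by auto
    qed
  qed
  then show ?thesis
    using \<chi> by (auto simp: infinitesimal_R_matrix_def)
qed

end
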